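(* Let $X$ and $Y$ be real Banach spaces such that $\mathcal{K}(X,Y^* )$ is separating for $X\hat{\otimes}_\pi Y$. If $z\in S_{\mathcal{L}(X,Y^* )^*}$ is a weak$^*$-strongly extreme point of $B_{\mathcal{L}(X,Y^* )^*}$, then $z=x\otimes y$ for some $x\in S_X$ and $y\in S_Y$ such that $x$ is a weak$^*$-strongly extreme point of $B_{X^{**}}$ and $y$ is a weak$^*$-strongly extreme point of $B_{Y^{**}}$.
   Context: $B_Z$ and $S_Z$ denote the closed unit ball and unit sphere of a Banach space $Z$; $Z$ is regarded as canonically embedded in $Z^{**}$. A weak$^*$-slice of $B_{Z^*}$ is a set $\{z^*\in B_{Z^*}: z^*(z)>\sup_{w^*\in B_{Z^*}}w^*(z)-\alpha\}$ with $z\in Z$ and $\alpha>0$. A point $z_0^*\in S_{Z^*}$ is a weak$^*$-strongly extreme point of $B_{Z^*}$ if the family of weak$^*$-slices of $B_{Z^*}$ containing $z_0^*$ forms a local base at $z_0^*$ for the (relative) weak topology on $B_{Z^*}$, the weak topology of $Z^*$ being the one induced by $Z^{**}$. $\mathcal{L}(X,Y^* )$ is the space of bounded linear operators from $X$ to $Y^*$, identified isometrically with the dual of the projective tensor product $X\hat{\otimes}_\pi Y$ via $T(x\otimes y)=(Tx)(y)$; thus $\mathcal{L}(X,Y^* )^*=(X\hat{\otimes}_\pi Y)^{**}$ is the dual of $\mathcal{L}(X,Y^* )$, with weak$^*$-slices given by elements of $\mathcal{L}(X,Y^* )$, and $x\otimes y$ is viewed in it through the canonical embedding, i.e. as the functional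 $T\mapsto(Tx)(y)$. $\mathcal{K}(X,Y^* )\subset\mathcal{L}(X,Y^* )$ is the subspace of compact operators; it is separating for $X\hat{\otimes}_\pi Y$ if for every nonzero $u\in X\hat{\otimes}_\pi Y$ there is $K\in\mathcal{K}(X,Y^* )$ with $K(u)\neq 0$. *)

theory Defs
  imports "HOL-Analysis.Analysis"
begin

section \<open>The algebraic tensor product\<close>

text \<open>The list of the pairs (x i, y i) stands for the finite sum of the x i \<otimes> y i. Such a sum is
  identified with the functional A \<mapsto> \<Sum>i. A (x i) (y i) on the space of all (not necessarily bounded)
  bilinear forms: two sums are equal iff every bilinear form takes the same value on them.\<close>

quotient_type (overloaded) ('a, 'b) alg_tensor =
    "('a::real_normed_vector \<times> 'b::real_normed_vector) list" /
    "\<lambda>s t. \<forall>A :: 'a \<Rightarrow> 'b \<Rightarrow> real. bilinear A \<longrightarrow> (\<Sum>(x, y)\<leftarrow>s. A x y) = (\<Sum>(x, y)\<leftarrow>t. A x y)"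
  by (rule equivpI) (auto simp: reflp_def symp_def transp_def)

lemma bilinear_sum_list_neg:
  fixes A :: "'a::real_normed_vector \<Rightarrow> 'b::real_normed_vector \<Rightarrow> real"
  assumes "bilinear A"
  shows "(\<Sum>(x, y)\<leftarrow>map (\<lambda>(x, y). (- x, y)) s. A x y) = - (\<Sum>(x, y)\<leftarrow>s. A x y)"
  by (induction s) (auto simp: bilinear_lneg[OF assms])

lemma bilinear_sum_list_scaleR:
  fixes A :: "'a::real_normed_vector \<Rightarrow> 'b::real_normed_vector \<Rightarrow> real"
  assumes "bilinear A"
  shows "(\<Sum>(x, y)\<leftarrow>map (\<lambda>(x, y). (c *\<^sub>R x, y)) s. A x y) = c * (\<Sum>(x, y)\<leftarrow>s. A x y)"
  by (induction s) (auto simp: bilinear_lmul[OF assms] algebra_simps)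

instantiation alg_tensor :: (real_normed_vector, real_normed_vector) real_vector
begin

lift_definition zero_alg_tensor :: "('a, 'b) alg_tensor" is "[]" .

lift_definition plus_alg_tensor :: "('a, 'b) alg_tensor \<Rightarrow> ('a, 'b) alg_tensor \<Rightarrow> ('a, 'b) alg_tensor"
  is "(@)" by simp

lift_definition uminus_alg_tensor :: "('a, 'b) alg_tensor \<Rightarrow> ('a, 'b) alg_tensor"
  is "map (\<lambda>(x, y). (- x, y))" by (simp only: bilinear_sum_list_neg)

lift_definition scaleR_alg_tensor :: "real \<Rightarrow> ('a, 'b) alg_tensor \<Rightarrow> ('a, 'b) alg_tensor"
  is "\<lambda>c. map (\<lambda>(x, y). (c *\<^sub>R x, y))" by (simp only: bilinear_sum_list_scaleR)

definition minus_alg_tensor :: "('a, 'b) alg_tensor \<Rightarrow> ('a, 'b) alg_tensor \<Rightarrow> ('a, 'b) alg_tensor"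
  where "minus_alg_tensor u v = u + - v"

instance
proof
  fix u v w :: "('a, 'b) alg_tensor" and a b :: real
  show "u + v + w = u + (v + w)" by transfer simp
  show "u + v = v + u" by transfer simp
  show "0 + u = u" by transfer simp
  show "- u + u = 0" by transfer (simp add: bilinear_sum_list_neg del: map_map)
  show "u - v = u + - v" by (simp add: minus_alg_tensor_def)
  show "a *\<^sub>R (u + v) = a *\<^sub>R u + a *\<^sub>R v" by transfer simp
  show "(a + b) *\<^sub>R u = a *\<^sub>R u + b *\<^sub>R u"
    by transfer (simp add: bilinear_sum_list_scaleR distrib_right del: map_map)
  show "a *\<^sub>R b *\<^sub>R u = (a * b) *\<^sub>R u"
    by transfer (simp add: bilinear_sum_list_scaleR algebra_simps del: map_map)
  show "1 *\<^sub>R u = u"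
    by transfer (simp add: bilinear_sum_list_scaleR del: map_map)
qed

end

lift_definition alg_tensor_elem :: "'a::real_normed_vector \<Rightarrow> 'b::real_normed_vector \<Rightarrow> ('a, 'b) alg_tensor"
  is "\<lambda>x y. [(x, y)]" .

lemma sum_list_alg_tensor_elem:
  "(\<Sum>(x, y)\<leftarrow>s. alg_tensor_elem x y) = abs_alg_tensor s"
  by (induction s)
     (auto simp: zero_alg_tensor_def alg_tensor_elem.abs_eq plus_alg_tensor.abs_eq)

lemma alg_tensor_exhaust: obtains s where "u = (\<Sum>(x, y)\<leftarrow>s. alg_tensor_elem x y)"
  unfolding sum_list_alg_tensor_elem
  using Quotient3_abs_rep[OF Quotient3_alg_tensor] by metis

section \<open>The projective norm\<close>

definition proj_norm :: "('a::real_normed_vector, 'b::real_normed_vector) alg_tensor \<Rightarrow> real" where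
  "proj_norm u =
     (INF s\<in>{s. u = (\<Sum>(x, y)\<leftarrow>s. alg_tensor_elem x y)}. \<Sum>(x, y)\<leftarrow>s. norm x * norm y)"

lemma sum_list_norm_nonneg: "0 \<le> (\<Sum>(x, y)\<leftarrow>s. norm x * norm y)"
  by (rule sum_list_nonneg) auto

lemma proj_norm_le: "proj_norm (\<Sum>(x, y)\<leftarrow>s. alg_tensor_elem x y) \<le> (\<Sum>(x, y)\<leftarrow>s. norm x * norm y)"
  unfolding proj_norm_def
  by (rule cINF_lower) (auto intro!: bdd_belowI2[where m = 0] sum_list_norm_nonneg)

lemma proj_norm_greatest:
  assumes "\<And>s. u = (\<Sum>(x, y)\<leftarrow>s. alg_tensor_elem x y) \<Longrightarrow> c \<le> (\<Sum>(x, y)\<leftarrow>s. norm x * norm y)"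
  shows "c \<le> proj_norm u"
  unfolding proj_norm_def
proof (rule cINF_greatest)
  show "{s. u = (\<Sum>(x, y)\<leftarrow>s. alg_tensor_elem x y)} \<noteq> {}"
    using alg_tensor_exhaust[of u] by blast
qed (use assms in auto)

lemma proj_norm_nonneg: "0 \<le> proj_norm u"
  by (rule proj_norm_greatest) (rule sum_list_norm_nonneg)

lemma proj_norm_0 [simp]: "proj_norm 0 = 0"
  by (rule antisym[OF _ proj_norm_nonneg]) (use proj_norm_le[of "[]"] in simp)

lemma proj_norm_approx:
  assumes "e > 0"
  obtains s where "u = (\<Sum>(x, y)\<leftarrow>s. alg_tensor_elem x y)"
    "(\<Sum>(x, y)\<leftarrow>s. norm x * norm y) < proj_norm u + e"
proof (rule ccontr)
  assume contr: "\<not> thesis"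
  note obt = that
  have "proj_norm u + e \<le> (\<Sum>(x, y)\<leftarrow>s. norm x * norm y)"
    if s: "u = (\<Sum>(x, y)\<leftarrow>s. alg_tensor_elem x y)" for s
    using contr obt[OF s] by (meson not_le)
  then have "proj_norm u + e \<le> proj_norm u" by (rule proj_norm_greatest)
  with assms show False by simp
qed

lemma proj_norm_triangle: "proj_norm (u + v) \<le> proj_norm u + proj_norm v"
proof (rule field_le_epsilon)
  fix e :: real assume "e > 0"
  then have e: "e / 2 > 0" by simp
  obtain s where s: "u = (\<Sum>(x, y)\<leftarrow>s. alg_tensor_elem x y)"
    "(\<Sum>(x, y)\<leftarrow>s. norm x * norm y) < proj_norm u + e / 2" by (rule proj_norm_approx[OF e])
  obtain t where t: "v = (\<Sum>(x, y)\<leftarrow>t. alg_tensor_elem x y)"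
    "(\<Sum>(x, y)\<leftarrow>t. norm x * norm y) < proj_norm v + e / 2" by (rule proj_norm_approx[OF e])
  have "proj_norm (u + v) \<le> (\<Sum>(x, y)\<leftarrow>s @ t. norm x * norm y)"
    using proj_norm_le[of "s @ t"] s(1) t(1) by simp
  with s(2) t(2) show "proj_norm (u + v) \<le> proj_norm u + proj_norm v + e" by simp
qed

lemma proj_norm_scaleR_le: "proj_norm (c *\<^sub>R u) \<le> \<bar>c\<bar> * proj_norm u"
proof (rule field_le_epsilon)
  fix e :: real assume e: "e > 0"
  define d where "d = e / (\<bar>c\<bar> + 1)"
  have d: "d > 0" "\<bar>c\<bar> * d \<le> e" using e by (auto simp: d_def field_simps)
  obtain s where s: "u = (\<Sum>(x, y)\<leftarrow>s. alg_tensor_elem x y)"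
    "(\<Sum>(x, y)\<leftarrow>s. norm x * norm y) < proj_norm u + d" by (rule proj_norm_approx[OF d(1)])
  let ?t = "map (\<lambda>(x, y). (c *\<^sub>R x, y)) s"
  have "c *\<^sub>R u = (\<Sum>(x, y)\<leftarrow>?t. alg_tensor_elem x y)"
    unfolding s(1) sum_list_alg_tensor_elem by (simp add: scaleR_alg_tensor.abs_eq)
  then have "proj_norm (c *\<^sub>R u) \<le> (\<Sum>(x, y)\<leftarrow>?t. norm x * norm y)"
    using proj_norm_le[of ?t] by simp
  also have "\<dots> = \<bar>c\<bar> * (\<Sum>(x, y)\<leftarrow>s. norm x * norm y)"
    by (induction s) (auto simp: algebra_simps)
  also have "\<dots> \<le> \<bar>c\<bar> * (proj_norm u + d)"
    using s(2) by (intro mult_left_mono) auto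
  also have "\<dots> \<le> \<bar>c\<bar> * proj_norm u + e"
    using d(2) by (simp add: algebra_simps)
  finally show "proj_norm (c *\<^sub>R u) \<le> \<bar>c\<bar> * proj_norm u + e" .
qed

lemma proj_norm_scaleR: "proj_norm (c *\<^sub>R u) = \<bar>c\<bar> * proj_norm u"
proof (cases "c = 0")
  case False
  have "proj_norm u \<le> \<bar>inverse c\<bar> * proj_norm (c *\<^sub>R u)"
    using proj_norm_scaleR_le[of "inverse c" "c *\<^sub>R u"] False by simp
  then have "\<bar>c\<bar> * proj_norm u \<le> proj_norm (c *\<^sub>R u)"
    using False by (simp add: abs_inverse field_simps)
  with proj_norm_scaleR_le[of c u] show ?thesis by simp
qed simp

lemma proj_norm_minus: "proj_norm (- u) = proj_norm u"
  using proj_norm_scaleR[of "-1" u] by simp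

lemma proj_norm_minus_commute: "proj_norm (u - v) = proj_norm (v - u)"
  by (metis minus_diff_eq proj_norm_minus)

lemma proj_norm_diff3: "proj_norm (u - w) \<le> proj_norm (u - v) + proj_norm (v - w)"
  using proj_norm_triangle[of "u - v" "v - w"] by simp

lemma proj_norm_diff_abs: "\<bar>proj_norm u - proj_norm v\<bar> \<le> proj_norm (u - v)"
  using proj_norm_triangle[of "u - v" v] proj_norm_triangle[of "v - u" u]
    proj_norm_minus_commute[of u v] by simp

lemma bilinear_blinfun2:
  fixes T :: "'a::real_normed_vector \<Rightarrow>\<^sub>L 'b::real_normed_vector \<Rightarrow>\<^sub>L real"
  shows "bilinear (\<lambda>x y. T x y)"
  by (auto simp: bilinear_def linear_iff blinfun.bilinear_simps)

lift_definition alg_pairing ::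
    "('a::real_normed_vector \<Rightarrow>\<^sub>L 'b::real_normed_vector \<Rightarrow>\<^sub>L real) \<Rightarrow> ('a, 'b) alg_tensor \<Rightarrow> real"
  is "\<lambda>T s. \<Sum>(x, y)\<leftarrow>s. blinfun_apply (blinfun_apply T x) y"
  using bilinear_blinfun2 by blast

lemma alg_pairing_elem: "alg_pairing T (alg_tensor_elem x y) = T x y"
  by transfer simp

lemma alg_pairing_add: "alg_pairing T (u + v) = alg_pairing T u + alg_pairing T v"
  by transfer simp

lemma alg_pairing_scaleR: "alg_pairing T (c *\<^sub>R u) = c * alg_pairing T u"
  by transfer (rule bilinear_sum_list_scaleR[OF bilinear_blinfun2])

lemma alg_pairing_diff: "alg_pairing T (u - v) = alg_pairing T u - alg_pairing T v"
  using alg_pairing_add[of T u "- v"] alg_pairing_scaleR[of T "-1" v] by simp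

lemma alg_pairing_bound: "\<bar>alg_pairing T u\<bar> \<le> norm T * proj_norm u"
proof (cases "T = 0")
  case True
  have "alg_pairing 0 u = 0" by transfer (auto simp: case_prod_unfold)
  with True show ?thesis by simp
next
  case False
  have bound: "\<bar>\<Sum>(x, y)\<leftarrow>s. T x y\<bar> \<le> norm T * (\<Sum>(x, y)\<leftarrow>s. norm x * norm y)" for s
  proof (induction s)
    case (Cons p s)
    obtain x y where p: "p = (x, y)" by force
    have "\<bar>T x y\<bar> \<le> norm (T x) * norm y" using norm_blinfun[of "T x" y] by simp
    also have "\<dots> \<le> norm T * norm x * norm y"
      by (intro mult_right_mono norm_blinfun) auto
    finally show ?case using Cons p by (auto simp: algebra_simps)
  qed simp
  have "\<bar>alg_pairing T u\<bar> / norm T \<le> proj_norm u"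
  proof (rule proj_norm_greatest)
    fix s assume "u = (\<Sum>(x, y)\<leftarrow>s. alg_tensor_elem x y)"
    then have "alg_pairing T u = (\<Sum>(x, y)\<leftarrow>s. T x y)"
      unfolding sum_list_alg_tensor_elem by (simp add: alg_pairing.abs_eq)
    with bound[of s] False show "\<bar>alg_pairing T u\<bar> / norm T \<le> (\<Sum>(x, y)\<leftarrow>s. norm x * norm y)"
      by (simp add: field_simps)
  qed
  with False show ?thesis by (simp add: field_simps)
qed

lifting_forget alg_tensor.lifting


section \<open>The projective tensor product\<close>

definition proj_Cauchy :: "(nat \<Rightarrow> ('a::real_normed_vector, 'b::real_normed_vector) alg_tensor) \<Rightarrow> bool"
  where "proj_Cauchy u \<longleftrightarrow> (\<forall>e>0. \<exists>N. \<forall>m\<ge>N. \<forall>n\<ge>N. proj_norm (u m - u n) < e)"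

lemma proj_Cauchy_const [simp]: "proj_Cauchy (\<lambda>n. c)"
  by (auto simp: proj_Cauchy_def)

lemma proj_Cauchy_add:
  assumes "proj_Cauchy u" "proj_Cauchy v" shows "proj_Cauchy (\<lambda>n. u n + v n)"
  unfolding proj_Cauchy_def
proof (intro allI impI)
  fix e :: real assume "e > 0"
  then have e: "e / 2 > 0" by simp
  obtain M where M: "\<And>m n. m \<ge> M \<Longrightarrow> n \<ge> M \<Longrightarrow> proj_norm (u m - u n) < e / 2"
    using assms(1) e unfolding proj_Cauchy_def by meson
  obtain N where N: "\<And>m n. m \<ge> N \<Longrightarrow> n \<ge> N \<Longrightarrow> proj_norm (v m - v n) < e / 2"
    using assms(2) e unfolding proj_Cauchy_def by meson
  have "proj_norm (u m + v m - (u n + v n)) < e" if "m \<ge> max M N" "n \<ge> max M N" for m n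
  proof -
    have eq: "u m + v m - (u n + v n) = (u m - u n) + (v m - v n)" by (simp add: algebra_simps)
    show ?thesis unfolding eq
      using proj_norm_triangle[of "u m - u n" "v m - v n"] M[of m n] N[of m n] that by auto
  qed
  then show "\<exists>N. \<forall>m\<ge>N. \<forall>n\<ge>N. proj_norm (u m + v m - (u n + v n)) < e" by blast
qed

lemma proj_Cauchy_scaleR:
  assumes "proj_Cauchy u" shows "proj_Cauchy (\<lambda>n. c *\<^sub>R u n)"
  unfolding proj_Cauchy_def
proof (intro allI impI)
  fix e :: real assume e: "e > 0"
  then obtain M where M: "\<And>m n. m \<ge> M \<Longrightarrow> n \<ge> M \<Longrightarrow> proj_norm (u m - u n) < e / (\<bar>c\<bar> + 1)"
    using assms unfolding proj_Cauchy_def by (metis abs_ge_zero add_nonneg_pos divide_pos_pos zero_less_one)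
  have "proj_norm (c *\<^sub>R u m - c *\<^sub>R u n) < e" if "m \<ge> M" "n \<ge> M" for m n
  proof -
    have "proj_norm (c *\<^sub>R u m - c *\<^sub>R u n) = \<bar>c\<bar> * proj_norm (u m - u n)"
      by (metis proj_norm_scaleR scaleR_diff_right)
    also have "\<dots> \<le> (\<bar>c\<bar> + 1) * proj_norm (u m - u n)"
      using proj_norm_nonneg by (intro mult_right_mono) auto
    also have "\<dots> < e" using M[OF that] by (simp add: field_simps)
    finally show ?thesis .
  qed
  then show "\<exists>N. \<forall>m\<ge>N. \<forall>n\<ge>N. proj_norm (c *\<^sub>R u m - c *\<^sub>R u n) < e" by blast
qed

lemma proj_Cauchy_minus: "proj_Cauchy u \<Longrightarrow> proj_Cauchy (\<lambda>n. - u n)"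
  using proj_Cauchy_scaleR[of u "-1"] by simp

lemma proj_Cauchy_diff: "proj_Cauchy u \<Longrightarrow> proj_Cauchy v \<Longrightarrow> proj_Cauchy (\<lambda>n. u n - v n)"
  using proj_Cauchy_add[OF _ proj_Cauchy_minus, of u v] by simp

lemma proj_Cauchy_norm_convergent:
  assumes "proj_Cauchy u" shows "(\<lambda>n. proj_norm (u n)) \<longlonglongrightarrow> lim (\<lambda>n. proj_norm (u n))"
proof -
  have "Cauchy (\<lambda>n. proj_norm (u n))"
    unfolding Cauchy_def dist_real_def
    using assms proj_norm_diff_abs unfolding proj_Cauchy_def by (meson le_less_trans)
  then show ?thesis by (simp add: Cauchy_convergent_iff convergent_LIMSEQ_iff)
qed

lemma proj_null_trans:
  assumes "(\<lambda>n. proj_norm (u n - v n)) \<longlonglongrightarrow> 0" "(\<lambda>n. proj_norm (v n - w n)) \<longlonglongrightarrow> 0"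
  shows "(\<lambda>n. proj_norm (u n - w n)) \<longlonglongrightarrow> 0"
  by (rule tendsto_sandwich[OF _ _ tendsto_const tendsto_add_zero[OF assms]])
     (auto simp: proj_norm_nonneg intro!: always_eventually proj_norm_diff3)

text \<open>The completion of the algebraic tensor product under the projective norm: Cauchy sequences
  modulo null sequences.\<close>

quotient_type (overloaded) ('a, 'b) proj_tensor =
    "nat \<Rightarrow> ('a::real_normed_vector, 'b::real_normed_vector) alg_tensor" / partial:
    "\<lambda>u v. proj_Cauchy u \<and> proj_Cauchy v \<and> (\<lambda>n. proj_norm (u n - v n)) \<longlonglongrightarrow> 0"
proof (rule part_equivpI)
  show "\<exists>u::nat \<Rightarrow> ('a, 'b) alg_tensor.
      proj_Cauchy u \<and> proj_Cauchy u \<and> (\<lambda>n. proj_norm (u n - u n)) \<longlonglongrightarrow> 0"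
    by (rule exI[of _ "\<lambda>n. 0"]) simp
qed (auto intro!: sympI transpI intro: proj_null_trans simp: proj_norm_minus_commute)

lemma proj_norm_lim_cong:
  assumes "proj_Cauchy u" "(\<lambda>n. proj_norm (u n - v n)) \<longlonglongrightarrow> 0"
  shows "lim (\<lambda>n. proj_norm (u n)) = lim (\<lambda>n. proj_norm (v n))"
proof -
  have "(\<lambda>n. proj_norm (u n) - proj_norm (v n)) \<longlonglongrightarrow> 0"
    by (rule tendsto_rabs_zero_cancel, rule tendsto_sandwich[OF _ _ tendsto_const assms(2)])
       (auto intro!: always_eventually proj_norm_diff_abs)
  from tendsto_diff[OF proj_Cauchy_norm_convergent[OF assms(1)] this]
  have "(\<lambda>n. proj_norm (v n)) \<longlonglongrightarrow> lim (\<lambda>n. proj_norm (u n))" by simp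
  then show ?thesis by (simp add: limI)
qed

lemma proj_null_add:
  assumes "(\<lambda>n. proj_norm (u n - u' n)) \<longlonglongrightarrow> 0" "(\<lambda>n. proj_norm (v n - v' n)) \<longlonglongrightarrow> 0"
  shows "(\<lambda>n. proj_norm (u n + v n - (u' n + v' n))) \<longlonglongrightarrow> 0"
proof (rule tendsto_sandwich[OF _ _ tendsto_const tendsto_add_zero[OF assms]])
  have "proj_norm (u n + v n - (u' n + v' n)) \<le> proj_norm (u n - u' n) + proj_norm (v n - v' n)" for n
    using proj_norm_triangle[of "u n - u' n" "v n - v' n"] by (simp add: algebra_simps)
  then show "\<forall>\<^sub>F n in sequentially. proj_norm (u n + v n - (u' n + v' n))
      \<le> proj_norm (u n - u' n) + proj_norm (v n - v' n)" by simp
qed (simp add: proj_norm_nonneg)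

lemma proj_null_scaleR:
  assumes "(\<lambda>n. proj_norm (u n - v n)) \<longlonglongrightarrow> 0"
  shows "(\<lambda>n. proj_norm (c *\<^sub>R u n - c *\<^sub>R v n)) \<longlonglongrightarrow> 0"
  using tendsto_mult_left[OF assms, of "\<bar>c\<bar>"]
  by (simp add: scaleR_diff_right[symmetric] proj_norm_scaleR)

instantiation proj_tensor :: (real_normed_vector, real_normed_vector) real_normed_vector
begin

lift_definition zero_proj_tensor :: "('a, 'b) proj_tensor" is "\<lambda>n. 0" by simp

lift_definition plus_proj_tensor ::
    "('a, 'b) proj_tensor \<Rightarrow> ('a, 'b) proj_tensor \<Rightarrow> ('a, 'b) proj_tensor"
  is "\<lambda>u v n. u n + v n" by (auto intro: proj_Cauchy_add proj_null_add)

lift_definition scaleR_proj_tensor :: "real \<Rightarrow> ('a, 'b) proj_tensor \<Rightarrow> ('a, 'b) proj_tensor"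
  is "\<lambda>c u n. c *\<^sub>R u n" by (auto intro: proj_Cauchy_scaleR proj_null_scaleR)

definition uminus_proj_tensor :: "('a, 'b) proj_tensor \<Rightarrow> ('a, 'b) proj_tensor"
  where "uminus_proj_tensor u = (- 1) *\<^sub>R u"

definition minus_proj_tensor ::
    "('a, 'b) proj_tensor \<Rightarrow> ('a, 'b) proj_tensor \<Rightarrow> ('a, 'b) proj_tensor"
  where "minus_proj_tensor u v = u + - v"

lift_definition norm_proj_tensor :: "('a, 'b) proj_tensor \<Rightarrow> real"
  is "\<lambda>u. lim (\<lambda>n. proj_norm (u n))" by (auto intro: proj_norm_lim_cong)

definition sgn_proj_tensor :: "('a, 'b) proj_tensor \<Rightarrow> ('a, 'b) proj_tensor"
  where "sgn_proj_tensor u = inverse (norm u) *\<^sub>R u"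

definition dist_proj_tensor :: "('a, 'b) proj_tensor \<Rightarrow> ('a, 'b) proj_tensor \<Rightarrow> real"
  where "dist_proj_tensor u v = norm (u - v)"

definition uniformity_proj_tensor :: "(('a, 'b) proj_tensor \<times> ('a, 'b) proj_tensor) filter"
  where "uniformity_proj_tensor = (INF e\<in>{0<..}. principal {(u, v). dist u v < e})"

definition open_proj_tensor :: "('a, 'b) proj_tensor set \<Rightarrow> bool"
  where "open_proj_tensor U \<longleftrightarrow> (\<forall>u\<in>U. \<forall>\<^sub>F (u', v) in uniformity. u' = u \<longrightarrow> v \<in> U)"

instance
proof
  fix u v w :: "('a, 'b) proj_tensor" and a b :: real and U :: "('a, 'b) proj_tensor set"
  show "u + v + w = u + (v + w)"
    by transfer (auto intro: proj_Cauchy_add simp: add.assoc)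
  show "u + v = v + u"
    by transfer (auto intro: proj_Cauchy_add simp: add.commute)
  show "0 + u = u" by transfer simp
  show "- u + u = 0" unfolding uminus_proj_tensor_def
    by transfer (auto intro: proj_Cauchy_add proj_Cauchy_minus)
  show "u - v = u + - v" by (simp add: minus_proj_tensor_def)
  show "a *\<^sub>R (u + v) = a *\<^sub>R u + a *\<^sub>R v"
    by transfer (auto intro: proj_Cauchy_add proj_Cauchy_scaleR simp: scaleR_right_distrib)
  show "(a + b) *\<^sub>R u = a *\<^sub>R u + b *\<^sub>R u"
    by transfer (auto intro: proj_Cauchy_add proj_Cauchy_scaleR simp: scaleR_left_distrib)
  show "a *\<^sub>R b *\<^sub>R u = (a * b) *\<^sub>R u"
    by transfer (auto intro: proj_Cauchy_scaleR)
  show "1 *\<^sub>R u = u" by transfer simp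
  show "dist u v = norm (u - v)" by (rule dist_proj_tensor_def)
  show "sgn u = inverse (norm u) *\<^sub>R u" by (rule sgn_proj_tensor_def)
  show "uniformity = (INF e\<in>{0<..}. principal {(u, v :: ('a, 'b) proj_tensor). dist u v < e})"
    by (rule uniformity_proj_tensor_def)
  show "open U \<longleftrightarrow> (\<forall>u\<in>U. \<forall>\<^sub>F (u', v) in uniformity. u' = u \<longrightarrow> v \<in> U)"
    by (rule open_proj_tensor_def)
  show "norm u = 0 \<longleftrightarrow> u = 0"
  proof transfer
    fix u :: "nat \<Rightarrow> ('a, 'b) alg_tensor"
    assume u: "proj_Cauchy u \<and> proj_Cauchy u \<and> (\<lambda>n. proj_norm (u n - u n)) \<longlonglongrightarrow> 0"
    then have c: "proj_Cauchy u" by simp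
    have "lim (\<lambda>n. proj_norm (u n)) = 0 \<longleftrightarrow> (\<lambda>n. proj_norm (u n)) \<longlonglongrightarrow> 0"
      using proj_Cauchy_norm_convergent[OF c] limI by metis
    with c show "(lim (\<lambda>n. proj_norm (u n)) = 0) =
        (proj_Cauchy u \<and> proj_Cauchy (\<lambda>n. 0 :: ('a, 'b) alg_tensor) \<and> (\<lambda>n. proj_norm (u n - 0)) \<longlonglongrightarrow> 0)"
      by simp
  qed
  show "norm (u + v) \<le> norm u + norm v"
  proof transfer
    fix u v :: "nat \<Rightarrow> ('a, 'b) alg_tensor"
    assume "proj_Cauchy u \<and> proj_Cauchy u \<and> (\<lambda>n. proj_norm (u n - u n)) \<longlonglongrightarrow> 0"
      "proj_Cauchy v \<and> proj_Cauchy v \<and> (\<lambda>n. proj_norm (v n - v n)) \<longlonglongrightarrow> 0"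
    then have uv: "proj_Cauchy u" "proj_Cauchy v" by auto
    show "lim (\<lambda>n. proj_norm (u n + v n)) \<le> lim (\<lambda>n. proj_norm (u n)) + lim (\<lambda>n. proj_norm (v n))"
      by (rule LIMSEQ_le[OF proj_Cauchy_norm_convergent[OF proj_Cauchy_add[OF uv]]
            tendsto_add[OF uv[THEN proj_Cauchy_norm_convergent]]])
         (auto intro: proj_norm_triangle)
  qed
  show "norm (a *\<^sub>R u) = \<bar>a\<bar> * norm u"
  proof transfer
    fix u :: "nat \<Rightarrow> ('a, 'b) alg_tensor" and a :: real
    assume "proj_Cauchy u \<and> proj_Cauchy u \<and> (\<lambda>n. proj_norm (u n - u n)) \<longlonglongrightarrow> 0"
    then have "(\<lambda>n. \<bar>a\<bar> * proj_norm (u n)) \<longlonglongrightarrow> \<bar>a\<bar> * lim (\<lambda>n. proj_norm (u n))"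
      by (auto intro: tendsto_mult_left proj_Cauchy_norm_convergent)
    then show "lim (\<lambda>n. proj_norm (a *\<^sub>R u n)) = \<bar>a\<bar> * lim (\<lambda>n. proj_norm (u n))"
      by (simp add: proj_norm_scaleR limI)
  qed
qed

end

lift_definition alg_to_proj ::
    "('a::real_normed_vector, 'b::real_normed_vector) alg_tensor \<Rightarrow> ('a, 'b) proj_tensor"
  is "\<lambda>u n. u" by simp

lemma norm_alg_to_proj: "norm (alg_to_proj u) = proj_norm u"
  by transfer (simp add: limI)

lemma alg_to_proj_add: "alg_to_proj (u + v) = alg_to_proj u + alg_to_proj v"
  by transfer simp

lemma alg_to_proj_scaleR: "alg_to_proj (c *\<^sub>R u) = c *\<^sub>R alg_to_proj u"
  by transfer simp

lemma alg_to_proj_dense: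
  assumes "e > 0" obtains v where "norm (u - alg_to_proj v) < e"
proof -
  have "\<exists>v. norm (u + (-1) *\<^sub>R alg_to_proj v) < e"
    using assms
  proof transfer
    fix e :: real and u :: "nat \<Rightarrow> ('a, 'b) alg_tensor"
    assume e: "e > 0" and "proj_Cauchy u \<and> proj_Cauchy u \<and> (\<lambda>n. proj_norm (u n - u n)) \<longlonglongrightarrow> 0"
    then have u: "proj_Cauchy u" by simp
    then obtain N where N: "\<And>m n. m \<ge> N \<Longrightarrow> n \<ge> N \<Longrightarrow> proj_norm (u m - u n) < e / 2"
      using e unfolding proj_Cauchy_def by (meson half_gt_zero)
    have "lim (\<lambda>n. proj_norm (u n - u N)) \<le> e / 2"
      using LIMSEQ_le_const2[OF proj_Cauchy_norm_convergent[OF proj_Cauchy_diff[OF u proj_Cauchy_const[of "u N"]]]]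
        N by (meson less_imp_le order_refl)
    with e have "lim (\<lambda>n. proj_norm (u n + (-1) *\<^sub>R u N)) < e" by simp
    then show "\<exists>v. lim (\<lambda>n. proj_norm (u n + (-1) *\<^sub>R v)) < e" by blast
  qed
  then show ?thesis using that by auto
qed

lemma alg_to_proj_diff: "alg_to_proj (u - v) = alg_to_proj u - alg_to_proj v"
  using alg_to_proj_add[of u "- v"] alg_to_proj_scaleR[of "-1" v] by simp

lemma alg_to_proj_tendsto_abs:
  assumes "proj_Cauchy v"
  shows "(\<lambda>n. alg_to_proj (v n)) \<longlonglongrightarrow> abs_proj_tensor v"
proof (rule metric_LIMSEQ_I)
  fix e :: real assume e: "e > 0"
  then obtain N where N: "\<And>m n. m \<ge> N \<Longrightarrow> n \<ge> N \<Longrightarrow> proj_norm (v m - v n) < e / 2"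
    using assms unfolding proj_Cauchy_def by (meson half_gt_zero)
  have "dist (alg_to_proj (v n)) (abs_proj_tensor v) < e" if "n \<ge> N" for n
  proof -
    have "abs_proj_tensor v + (-1) *\<^sub>R alg_to_proj (v n) = abs_proj_tensor (\<lambda>k. v k + (-1) *\<^sub>R v n)"
      unfolding alg_to_proj.abs_eq using assms
      by (subst scaleR_proj_tensor.abs_eq, simp, subst plus_proj_tensor.abs_eq)
         (auto intro: proj_Cauchy_minus)
    then have "norm (abs_proj_tensor v - alg_to_proj (v n)) = norm (abs_proj_tensor (\<lambda>k. v k - v n))"
      by simp
    also have "\<dots> = lim (\<lambda>k. proj_norm (v k - v n))"
      using assms by (subst norm_proj_tensor.abs_eq) (auto intro: proj_Cauchy_diff)
    also have "\<dots> \<le> e / 2"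
      using LIMSEQ_le_const2[OF proj_Cauchy_norm_convergent[OF proj_Cauchy_diff[OF assms proj_Cauchy_const[of "v n"]]]]
        N that by (meson less_imp_le)
    finally show ?thesis using e by (simp add: dist_norm norm_minus_commute)
  qed
  then show "\<exists>N. \<forall>n\<ge>N. dist (alg_to_proj (v n)) (abs_proj_tensor v) < e"
    by (intro exI[of _ N] allI impI)
qed

instance proj_tensor :: (real_normed_vector, real_normed_vector) banach
proof
  fix U :: "nat \<Rightarrow> ('a, 'b) proj_tensor"
  assume U: "Cauchy U"
  have "\<exists>v. norm (U n - alg_to_proj v) < inverse (real (Suc n))" for n
  proof -
    have "inverse (real (Suc n)) > 0" by simp
    then obtain w where "norm (U n - alg_to_proj w) < inverse (real (Suc n))"
      by (rule alg_to_proj_dense)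
    then show ?thesis ..
  qed
  then have "\<exists>v. \<forall>n. norm (U n - alg_to_proj (v n)) < inverse (real (Suc n))"
    by (intro choice allI)
  then obtain v where v: "\<And>n. norm (U n - alg_to_proj (v n)) < inverse (real (Suc n))"
    by blast
  have null: "(\<lambda>n. U n - alg_to_proj (v n)) \<longlonglongrightarrow> 0"
    by (rule Lim_null_comparison[OF _ LIMSEQ_inverse_real_of_nat]) (rule always_eventually, rule allI, rule less_imp_le, rule v)
  have "Cauchy (\<lambda>n. alg_to_proj (v n))"
  proof (rule metric_CauchyI)
    fix e :: real assume "e > 0"
    then have e: "e / 3 > 0" by simp
    obtain M where M: "\<And>m n. m \<ge> M \<Longrightarrow> n \<ge> M \<Longrightarrow> dist (U m) (U n) < e / 3"
      using metric_CauchyD[OF U e] by blast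
    obtain N where N: "\<And>n. n \<ge> N \<Longrightarrow> dist (U n) (alg_to_proj (v n)) < e / 3"
      using metric_LIMSEQ_D[OF null e] by (auto simp: dist_norm)
    have "dist (alg_to_proj (v m)) (alg_to_proj (v n)) < e" if "m \<ge> max M N" "n \<ge> max M N" for m n
    proof -
      have "dist (alg_to_proj (v m)) (alg_to_proj (v n))
          \<le> dist (U m) (alg_to_proj (v m)) + dist (U m) (U n) + dist (U n) (alg_to_proj (v n))"
        using dist_triangle[of "alg_to_proj (v m)" "alg_to_proj (v n)" "U m"]
          dist_triangle[of "U m" "alg_to_proj (v n)" "U n"] by (simp add: dist_commute)
      also have "\<dots> < e" using M[of m n] N[of m] N[of n] that by simp
      finally show ?thesis .
    qed
    then show "\<exists>N. \<forall>m\<ge>N. \<forall>n\<ge>N. dist (alg_to_proj (v m)) (alg_to_proj (v n)) < e"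
      by (intro exI[of _ "max M N"] allI impI)
  qed
  then have "proj_Cauchy v"
    unfolding Cauchy_def proj_Cauchy_def dist_norm
    by (simp add: alg_to_proj_diff[symmetric] norm_alg_to_proj)
  from tendsto_add[OF null alg_to_proj_tendsto_abs[OF this]]
  have "U \<longlonglongrightarrow> abs_proj_tensor v" by simp
  then show "convergent U" by (auto simp: convergent_def)
qed

definition proj_tensor_elem :: "'a::real_normed_vector \<Rightarrow> 'b::real_normed_vector \<Rightarrow> ('a, 'b) proj_tensor"
  where "proj_tensor_elem x y = alg_to_proj (alg_tensor_elem x y)"


section \<open>Operators as functionals on the projective tensor product\<close>

lemma alg_pairing_null:
  assumes "(\<lambda>n. proj_norm (u n - v n)) \<longlonglongrightarrow> 0"
  shows "(\<lambda>n. alg_pairing T (u n) - alg_pairing T (v n)) \<longlonglongrightarrow> 0"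
proof (rule Lim_null_comparison)
  show "(\<lambda>n. norm T * proj_norm (u n - v n)) \<longlonglongrightarrow> 0"
    using tendsto_mult_left[OF assms, of "norm T"] by simp
  show "\<forall>\<^sub>F n in sequentially.
      norm (alg_pairing T (u n) - alg_pairing T (v n)) \<le> norm T * proj_norm (u n - v n)"
    using alg_pairing_bound[of T] by (simp add: alg_pairing_diff[symmetric])
qed

lemma alg_pairing_convergent:
  assumes "proj_Cauchy u"
  shows "(\<lambda>n. alg_pairing T (u n)) \<longlonglongrightarrow> lim (\<lambda>n. alg_pairing T (u n))"
proof -
  have "Cauchy (\<lambda>n. alg_pairing T (u n))"
  proof (rule CauchyI)
    fix e :: real assume e: "e > 0"
    have "e / (norm T + 1) > 0" using e by (simp add: add_nonneg_pos)
    then obtain N where N: "\<And>m n. m \<ge> N \<Longrightarrow> n \<ge> N \<Longrightarrow> proj_norm (u m - u n) < e / (norm T + 1)"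
      using assms unfolding proj_Cauchy_def by meson
    have "norm (alg_pairing T (u m) - alg_pairing T (u n)) < e" if "m \<ge> N" "n \<ge> N" for m n
    proof -
      have "norm (alg_pairing T (u m) - alg_pairing T (u n)) \<le> norm T * proj_norm (u m - u n)"
        using alg_pairing_bound[of T] by (simp add: alg_pairing_diff[symmetric])
      also have "\<dots> \<le> (norm T + 1) * proj_norm (u m - u n)"
        using proj_norm_nonneg by (intro mult_right_mono) auto
      also have "\<dots> < e"
        using N[OF that]
        by (subst (asm) pos_less_divide_eq) (simp_all add: add_nonneg_pos mult.commute)
      finally show ?thesis .
    qed
    then show "\<exists>N. \<forall>m\<ge>N. \<forall>n\<ge>N. norm (alg_pairing T (u m) - alg_pairing T (u n)) < e" by blast
  qed
  then show ?thesis by (simp add: Cauchy_convergent_iff convergent_LIMSEQ_iff)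
qed

text \<open>The identification of an operator T from X to Y* with a functional on the projective tensor
  product: the continuous extension of x \<otimes> y \<mapsto> (T x) y.\<close>

lift_definition tensor_pairing ::
    "('a::real_normed_vector \<Rightarrow>\<^sub>L 'b::real_normed_vector \<Rightarrow>\<^sub>L real) \<Rightarrow> ('a, 'b) proj_tensor \<Rightarrow> real"
  is "\<lambda>T u. lim (\<lambda>n. alg_pairing T (u n))"
proof -
  fix T :: "'a \<Rightarrow>\<^sub>L 'b \<Rightarrow>\<^sub>L real" and u v :: "nat \<Rightarrow> ('a, 'b) alg_tensor"
  assume uv: "proj_Cauchy u \<and> proj_Cauchy v \<and> (\<lambda>n. proj_norm (u n - v n)) \<longlonglongrightarrow> 0"
  then have "(\<lambda>n. alg_pairing T (v n)) \<longlonglongrightarrow> lim (\<lambda>n. alg_pairing T (u n))"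
    using tendsto_diff[OF alg_pairing_convergent[of u T] alg_pairing_null[of u v T]] by simp
  then show "lim (\<lambda>n. alg_pairing T (u n)) = lim (\<lambda>n. alg_pairing T (v n))"
    by (simp add: limI)
qed

lemma tensor_pairing_elem: "tensor_pairing T (proj_tensor_elem x y) = T x y"
proof -
  have "tensor_pairing T (alg_to_proj u) = alg_pairing T u" for u
    by transfer (simp add: limI)
  then show ?thesis by (simp add: proj_tensor_elem_def alg_pairing_elem)
qed

lemma bounded_linear_tensor_pairing:
  fixes T :: "'a::real_normed_vector \<Rightarrow>\<^sub>L 'b::real_normed_vector \<Rightarrow>\<^sub>L real"
  shows "bounded_linear (tensor_pairing T)"
proof (rule bounded_linear_intro)
  fix u v :: "('a, 'b) proj_tensor" and c :: real
  show "tensor_pairing T (u + v) = tensor_pairing T u + tensor_pairing T v"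
    by transfer
      (auto simp: alg_pairing_add intro!: limI tendsto_add alg_pairing_convergent)
  show "tensor_pairing T (c *\<^sub>R u) = c *\<^sub>R tensor_pairing T u"
    by transfer
      (auto simp: alg_pairing_scaleR intro!: limI tendsto_mult_left alg_pairing_convergent)
  show "norm (tensor_pairing T u) \<le> norm u * norm T"
  proof (transfer fixing: T)
    fix u :: "nat \<Rightarrow> ('a, 'b) alg_tensor"
    assume "proj_Cauchy u \<and> proj_Cauchy u \<and> (\<lambda>n. proj_norm (u n - u n)) \<longlonglongrightarrow> 0"
    then have u: "proj_Cauchy u" by simp
    show "norm (lim (\<lambda>n. alg_pairing T (u n))) \<le> lim (\<lambda>n. proj_norm (u n)) * norm T"
      by (rule LIMSEQ_le[OF tendsto_norm[OF alg_pairing_convergent[OF u]]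
            tendsto_mult_right[OF proj_Cauchy_norm_convergent[OF u]]])
         (use alg_pairing_bound[of T] in \<open>auto simp: mult.commute[of _ "norm T"]\<close>)
  qed
qed

definition compact_operator :: "('a::real_normed_vector \<Rightarrow>\<^sub>L 'b::real_normed_vector) \<Rightarrow> bool" where
  "compact_operator T \<longleftrightarrow> compact (closure (blinfun_apply T ` cball 0 1))"

definition compact_operators_separating ::
    "'a::real_normed_vector itself \<Rightarrow> 'b::real_normed_vector itself \<Rightarrow> bool" where
  "compact_operators_separating _ _ \<longleftrightarrow>
     (\<forall>u :: ('a, 'b) proj_tensor. u \<noteq> 0 \<longrightarrow>
        (\<exists>K :: 'a \<Rightarrow>\<^sub>L 'b \<Rightarrow>\<^sub>L real. compact_operator K \<and> tensor_pairing K u \<noteq> 0))"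


section \<open>Canonical embeddings\<close>

definition bidual_embed :: "'z::real_normed_vector \<Rightarrow> ('z \<Rightarrow>\<^sub>L real) \<Rightarrow>\<^sub>L real" where
  "bidual_embed z = Blinfun (\<lambda>f. blinfun_apply f z)"

lemma bidual_embed_apply [simp]: "blinfun_apply (bidual_embed z) f = f z"
  unfolding bidual_embed_def
  by (simp add: bounded_linear_Blinfun_apply blinfun.bounded_linear_left)

text \<open>The elementary tensor x \<otimes> y as an element of the dual of the space of operators.\<close>

definition tensor_functional ::
    "'a::real_normed_vector \<Rightarrow> 'b::real_normed_vector \<Rightarrow> ('a \<Rightarrow>\<^sub>L 'b \<Rightarrow>\<^sub>L real) \<Rightarrow>\<^sub>L real" where
  "tensor_functional x y = Blinfun (\<lambda>T. blinfun_apply (blinfun_apply T x) y)"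

lemma tensor_functional_apply [simp]: "blinfun_apply (tensor_functional x y) T = T x y"
proof -
  have "bounded_linear (\<lambda>T :: 'a \<Rightarrow>\<^sub>L 'b \<Rightarrow>\<^sub>L real. T x y)"
    by (rule bounded_linear_compose[OF blinfun.bounded_linear_left blinfun.bounded_linear_left])
  then show ?thesis unfolding tensor_functional_def by (simp add: bounded_linear_Blinfun_apply)
qed

lemma tensor_functional_eq_pairing:
  "blinfun_apply (tensor_functional x y) T = tensor_pairing T (proj_tensor_elem x y)"
  by (simp add: tensor_pairing_elem)


section \<open>Weak-star strongly extreme points\<close>

definition weak_topology :: "'z::real_normed_vector topology" where
  "weak_topology = topology_generated_by {blinfun_apply f -` U |(f :: 'z \<Rightarrow>\<^sub>L real) U. open U}"

definition weakstar_slice :: "'z::real_normed_vector \<Rightarrow> real \<Rightarrow> ('z \<Rightarrow>\<^sub>L real) set" where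
  "weakstar_slice z \<alpha> = {f \<in> cball 0 1. blinfun_apply f z > (SUP g\<in>cball 0 1. blinfun_apply g z) - \<alpha>}"

definition local_base_at :: "'a topology \<Rightarrow> 'a \<Rightarrow> 'a set set \<Rightarrow> bool" where
  "local_base_at T p \<B> \<longleftrightarrow>
     (\<forall>V\<in>\<B>. openin T V \<and> p \<in> V) \<and> (\<forall>U. openin T U \<and> p \<in> U \<longrightarrow> (\<exists>V\<in>\<B>. V \<subseteq> U))"

text \<open>The topology used on the dual ball is its weak topology (tested against the bidual), not the
  weak-star topology.\<close>

definition weakstar_strongly_extreme :: "('z::real_normed_vector \<Rightarrow>\<^sub>L real) \<Rightarrow> bool" where
  "weakstar_strongly_extreme f \<longleftrightarrow>
     f \<in> sphere 0 1 \<and>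
     local_base_at (subtopology weak_topology (cball 0 1)) f
       {weakstar_slice z \<alpha> |z \<alpha>. \<alpha> > 0 \<and> f \<in> weakstar_slice z \<alpha>}"

end

theory Submission
  imports Defs
begin

text \<open>Why \<open>z\<close> is an elementary tensor. Every weak-star slice of the ball of functionals on operators
  contains some \<open>x \<otimes> y\<close> with \<open>x\<close> and \<open>y\<close> in the unit balls, because operator norms are suprema of values
  \<open>T x y\<close>. As slices refine all weak neighbourhoods of \<open>z\<close>, elementary tensors converge weakly to \<open>z\<close>
  (\<open>weak_neighbourhood_contains_elementary_tensor\<close>). A norm closed subspace is weakly closed, so \<open>z\<close> lies
  in the projective tensor product (\<open>weakstar_strongly_extreme_in_proj_tensor\<close>). Its slices by functionals
  are then vectors of the two Banach spaces rather than of their biduals, which identifies the weak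
  limits \<open>x\<close> and \<open>y\<close> of the two factors. Compact operators turn weak into norm convergence and hence
  cannot distinguish \<open>z\<close> from \<open>x \<otimes> y\<close>; since they separate, the two agree
  (\<open>elementary_tensor_limit\<close>).

  Why the factors are strongly extreme. The maps \<open>\<psi> \<mapsto> \<psi> \<otimes> y\<close> and \<open>\<psi> \<mapsto> x \<otimes> \<psi>\<close> from the biduals are
  adjoints of contractions, so they pull weak-star slices back to weak-star slices, and they have weakly
  continuous left inverses, given by slicing with functionals that take the value one at \<open>y\<close> and \<open>x\<close>.
  Strong extremality at \<open>x \<otimes> y\<close> therefore passes to \<open>x\<close> and \<open>y\<close> (\<open>weakstar_strongly_extreme_factor\<close>).

  The functional analysis behind this is the Hahn-Banach theorem, in the form of a linear functional
  below a sublinear one and equal to it at a given point (\<open>hahn_banach_sublinear\<close>).\<close>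

section \<open>The Hahn-Banach theorem\<close>

text \<open>Nonnegative homogeneity is only asked for as an inequality, which is easier to verify; equality
  follows by scaling back.\<close>
definition sublinear :: "('v::real_vector \<Rightarrow> real) \<Rightarrow> bool" where
  "sublinear p \<longleftrightarrow> (\<forall>x y. p (x + y) \<le> p x + p y) \<and> (\<forall>t\<ge>0. \<forall>x. p (t *\<^sub>R x) \<le> t * p x)"

lemma sublinear_add: "sublinear p \<Longrightarrow> p (x + y) \<le> p x + p y"
  and sublinear_scaleR: "sublinear p \<Longrightarrow> t \<ge> 0 \<Longrightarrow> p (t *\<^sub>R x) \<le> t * p x"
  by (auto simp: sublinear_def)

lemma sublinear_0: "sublinear p \<Longrightarrow> p 0 = 0"
  using sublinear_add[of p 0 0] sublinear_scaleR[of p 0 0] by simp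

lemma sublinear_minus: "sublinear p \<Longrightarrow> - p (- x) \<le> p x"
  using sublinear_add[of p x "- x"] sublinear_0[of p] by simp

lemma sublinear_scaleR_eq:
  assumes p: "sublinear p" and t: "t \<ge> 0" shows "p (t *\<^sub>R x) = t * p x"
proof (cases "t = 0")
  case True
  then show ?thesis using sublinear_0[OF p] by simp
next
  case False
  have "p (inverse t *\<^sub>R t *\<^sub>R x) \<le> inverse t * p (t *\<^sub>R x)"
    using t by (intro sublinear_scaleR[OF p]) simp
  then have "t * p x \<le> p (t *\<^sub>R x)" using False t by (simp add: field_simps)
  with sublinear_scaleR[OF p t, of x] show ?thesis by simp
qed

text \<open>Pushing \<open>p\<close> down as far as subadditivity along the ray through \<open>v\<close> permits. The infimum of
  \<open>p (x + t v) - t p v\<close> over \<open>t \<ge> 0\<close> is finite because \<open>p (x + t v) + p (- x) \<ge> t p v\<close>, and at \<open>x = - v\<close>,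
  \<open>t = 1\<close> it is at most \<open>- p v\<close>. This one construction serves twice: it makes minimal sublinear
  functionals odd, and it makes the linear functional found below touch \<open>p\<close> at \<open>v\<close>.\<close>
lemma sublinear_tilt:
  assumes p: "sublinear p"
  obtains q where "sublinear q" "q \<le> p" "q (- v) \<le> - p v"
proof
  define q where "q x = (INF t\<in>{0..}. p (x + t *\<^sub>R v) - t * p v)" for x
  have bdd: "bdd_below ((\<lambda>t. p (x + t *\<^sub>R v) - t * p v) ` {0..})" for x
  proof (rule bdd_belowI2)
    fix t :: real assume "t \<in> {0..}"
    then have "t * p v \<le> p (x + t *\<^sub>R v) + p (- x)"
      using sublinear_add[OF p, of "x + t *\<^sub>R v" "- x"] sublinear_scaleR_eq[OF p, of t v] by simp
    then show "- p (- x) \<le> p (x + t *\<^sub>R v) - t * p v" by simp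
  qed
  have lower: "q x \<le> p (x + t *\<^sub>R v) - t * p v" if "t \<ge> 0" for x t
    unfolding q_def by (rule cINF_lower[OF bdd]) (use that in simp)
  have greatest: "c \<le> q x" if "\<And>t. t \<ge> 0 \<Longrightarrow> c \<le> p (x + t *\<^sub>R v) - t * p v" for x c
    unfolding q_def by (rule cINF_greatest) (use that in auto)
  show "sublinear q"
    unfolding sublinear_def
  proof safe
    fix x y
    have "q (x + y) - (p (y + t *\<^sub>R v) - t * p v) \<le> q x" if t: "t \<ge> 0" for t
    proof (rule greatest)
      fix s :: real assume s: "s \<ge> 0"
      have "q (x + y) \<le> p (x + y + (s + t) *\<^sub>R v) - (s + t) * p v"
        using s t by (intro lower) simp
      also have "x + y + (s + t) *\<^sub>R v = (x + s *\<^sub>R v) + (y + t *\<^sub>R v)"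
        by (simp add: algebra_simps)
      finally show "q (x + y) - (p (y + t *\<^sub>R v) - t * p v) \<le> p (x + s *\<^sub>R v) - s * p v"
        using sublinear_add[OF p, of "x + s *\<^sub>R v" "y + t *\<^sub>R v"] by (simp add: algebra_simps)
    qed
    then have "q (x + y) - q x \<le> q y" by (intro greatest) (force simp: algebra_simps)
    then show "q (x + y) \<le> q x + q y" by simp
  next
    fix c :: real and x assume c: "c \<ge> 0"
    show "q (c *\<^sub>R x) \<le> c * q x"
    proof (cases "c = 0")
      case True
      then show ?thesis using lower[of 0 0] sublinear_0[OF p] by simp
    next
      case False
      have "q (c *\<^sub>R x) / c \<le> q x"
      proof (rule greatest)
        fix t :: real assume t: "t \<ge> 0"
        have "q (c *\<^sub>R x) \<le> p (c *\<^sub>R x + (c * t) *\<^sub>R v) - (c * t) * p v"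
          using c t by (intro lower) simp
        also have "\<dots> = c * (p (x + t *\<^sub>R v) - t * p v)"
          using sublinear_scaleR_eq[OF p c, of "x + t *\<^sub>R v"]
          by (simp add: scaleR_right_distrib right_diff_distrib)
        finally show "q (c *\<^sub>R x) / c \<le> p (x + t *\<^sub>R v) - t * p v"
          using c False by (simp add: field_simps)
      qed
      then show ?thesis using c False by (simp add: field_simps)
    qed
  qed
  show "q \<le> p" using lower[of 0] by (auto simp: le_fun_def)
  show "q (- v) \<le> - p v" using lower[of 1 "- v"] sublinear_0[OF p] by simp
qed

text \<open>The pointwise infimum of sublinear functionals is in general not subadditive. For a chain it is: in
  \<open>q x + r y\<close> both functionals may be replaced by the smaller of the two.\<close>
lemma sublinear_Inf_chain:
  assumes "C \<noteq> {}" and sub: "\<And>q. q \<in> C \<Longrightarrow> sublinear q" and le: "\<And>q. q \<in> C \<Longrightarrow> q \<le> p"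
    and chain: "\<And>q r. q \<in> C \<Longrightarrow> r \<in> C \<Longrightarrow> q \<le> r \<or> r \<le> q"
  obtains u where "sublinear u" "\<And>q. q \<in> C \<Longrightarrow> u \<le> q"
proof
  define u where "u x = (INF q\<in>C. q x)" for x
  have bdd: "bdd_below ((\<lambda>q. q x) ` C)" for x
  proof (rule bdd_belowI2)
    fix q assume q: "q \<in> C"
    show "- p (- x) \<le> q x"
      using sublinear_minus[OF sub[OF q], of x] le_funD[OF le[OF q], of "- x"] by simp
  qed
  have lower: "u x \<le> q x" if "q \<in> C" for x q
    unfolding u_def by (rule cINF_lower[OF bdd that])
  have greatest: "c \<le> u x" if "\<And>q. q \<in> C \<Longrightarrow> c \<le> q x" for x c
    unfolding u_def by (rule cINF_greatest[OF assms(1)]) (rule that)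
  show "u \<le> q" if "q \<in> C" for q using lower[OF that] by (simp add: le_fun_def)
  show "sublinear u"
    unfolding sublinear_def
  proof safe
    fix x y
    have "u (x + y) \<le> q x + r y" if qr: "q \<in> C" "r \<in> C" for q r
    proof -
      have "\<exists>m\<in>C. m \<le> q \<and> m \<le> r" using chain[OF qr] qr by auto
      then obtain m where m: "m \<in> C" "m \<le> q" "m \<le> r" by blast
      have "u (x + y) \<le> m x + m y"
        using lower[OF m(1), of "x + y"] sublinear_add[OF sub[OF m(1)], of x y] by simp
      also have "\<dots> \<le> q x + r y" using m by (intro add_mono) (auto simp: le_fun_def)
      finally show ?thesis .
    qed
    then have "u (x + y) - r y \<le> u x" if "r \<in> C" for r
      using that by (intro greatest) (simp add: diff_le_eq)
    then have "u (x + y) - u x \<le> u y" by (intro greatest) (force simp: algebra_simps)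
    then show "u (x + y) \<le> u x + u y" by simp
  next
    fix t :: real and x assume t: "t \<ge> 0"
    show "u (t *\<^sub>R x) \<le> t * u x"
    proof (cases "t = 0")
      case True
      obtain q where "q \<in> C" using assms(1) by blast
      with True show ?thesis using lower[of q 0] sublinear_0[OF sub[of q]] by simp
    next
      case False
      have "u (t *\<^sub>R x) / t \<le> u x"
      proof (rule greatest)
        fix q assume q: "q \<in> C"
        show "u (t *\<^sub>R x) / t \<le> q x"
          using lower[OF q, of "t *\<^sub>R x"] sublinear_scaleR[OF sub[OF q] t, of x] t False
          by (simp add: field_simps)
      qed
      then show ?thesis using t False by (simp add: field_simps)
    qed
  qed
qed

text \<open>By Zorn's lemma there is a minimal sublinear functional below \<open>p\<close>. It agrees with each of its
  tilts, so it is odd, and an odd sublinear functional is linear.\<close>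
lemma sublinear_dominates_linear:
  assumes p: "sublinear p"
  obtains f where "linear f" "f \<le> p"
proof -
  define M where "M = {q. sublinear q \<and> q \<le> p}"
  \<comment> \<open>Zorn's lemma yields maximal elements, so the order is reversed.\<close>
  let ?R = "\<lambda>q r :: 'a \<Rightarrow> real. r \<le> q"
  have "\<exists>q\<in>M. \<forall>r\<in>M. ?R q r \<longrightarrow> r = q"
  proof (rule predicate_Zorn)
    show "partial_order_on M (relation_of ?R M)"
      by (rule partial_order_on_relation_ofI) auto
    fix C assume "C \<in> Chains (relation_of ?R M)"
    then have C: "C \<subseteq> M" "\<And>q r. q \<in> C \<Longrightarrow> r \<in> C \<Longrightarrow> q \<le> r \<or> r \<le> q"
      by (auto simp: Chains_def relation_of_def)
    show "\<exists>u\<in>M. \<forall>q\<in>C. u \<le> q"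
    proof (cases "C = {}")
      case True
      then show ?thesis using p by (auto simp: M_def)
    next
      case False
      obtain u where u: "sublinear u" "\<And>q. q \<in> C \<Longrightarrow> u \<le> q"
        by (rule sublinear_Inf_chain[of C p]) (use False C in \<open>auto simp: M_def\<close>)
      obtain q where "q \<in> C" using False by blast
      then have "u \<le> p" using u(2)[of q] C(1) order_trans[of u q p] by (auto simp: M_def)
      with u show ?thesis by (auto simp: M_def)
    qed
  qed
  then obtain q where "q \<in> M" and min: "\<And>r. r \<in> M \<Longrightarrow> r \<le> q \<Longrightarrow> r = q" by blast
  then have q: "sublinear q" "q \<le> p" by (auto simp: M_def)
  have odd: "q (- v) = - q v" for v
  proof -
    obtain r where r: "sublinear r" "r \<le> q" "r (- v) \<le> - q v" by (rule sublinear_tilt[OF q(1)])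
    have "r = q" using r q(2) by (intro min) (auto simp: M_def)
    with r(3) sublinear_minus[OF q(1), of v] show ?thesis by simp
  qed
  have "linear q"
  proof (rule linearI)
    fix x y
    show "q (x + y) = q x + q y"
      using sublinear_add[OF q(1), of x y] sublinear_add[OF q(1), of "x + y" "- y"] odd[of y] by simp
  next
    fix t :: real and x
    show "q (t *\<^sub>R x) = t *\<^sub>R q x"
    proof (cases "t \<ge> 0")
      case False
      then show ?thesis using sublinear_scaleR_eq[OF q(1), of "- t" x] odd[of "t *\<^sub>R x"] by simp
    qed (simp add: sublinear_scaleR_eq[OF q(1)])
  qed
  with q(2) show ?thesis using that by blast
qed

text \<open>Replacing \<open>p\<close> by its tilt at \<open>v\<close> before choosing the linear functional forces
  \<open>f (- v) \<le> - p v\<close>, that is, equality at \<open>v\<close>.\<close>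
theorem hahn_banach_sublinear:
  assumes "sublinear p"
  obtains f where "linear f" "f \<le> p" "f v = p v"
proof -
  obtain q where q: "sublinear q" "q \<le> p" "q (- v) \<le> - p v" by (rule sublinear_tilt[OF assms])
  obtain f where f: "linear f" "f \<le> q" by (rule sublinear_dominates_linear[OF q(1)])
  have "f (- v) \<le> - p v" using le_funD[OF f(2), of "- v"] q(3) by simp
  then have "p v \<le> f v" using linear_neg[OF f(1), of v] by simp
  moreover have "f \<le> p" using f(2) q(2) by (rule order_trans)
  ultimately show ?thesis using that[OF f(1)] le_funD[of f p v] by simp
qed

lemma norming_functional:
  fixes v :: "'v::real_normed_vector"
  obtains f :: "'v \<Rightarrow>\<^sub>L real" where "norm f \<le> 1" "f v = norm v"
proof -
  have "sublinear (norm :: 'v \<Rightarrow> real)" by (auto simp: sublinear_def norm_triangle_ineq)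
  then obtain f :: "'v \<Rightarrow> real" where f: "linear f" "f \<le> norm" "f v = norm v"
    by (rule hahn_banach_sublinear)
  have bound: "norm (f x) \<le> norm x * 1" for x
    using le_funD[OF f(2), of x] le_funD[OF f(2), of "- x"] linear_neg[OF f(1), of x]
    by (simp add: abs_le_iff)
  have bl: "bounded_linear f"
    using f(1) bound by (intro bounded_linear_intro[of f 1]) (auto simp: linear_add linear_scale)
  show ?thesis
  proof
    show "norm (Blinfun f) \<le> 1"
      using bound by (intro norm_blinfun_bound) (simp_all add: bounded_linear_Blinfun_apply[OF bl])
    show "Blinfun f v = norm v" using f(3) by (simp add: bounded_linear_Blinfun_apply[OF bl])
  qed
qed

text \<open>The Hahn-Banach theorem for the distance to \<open>S\<close>, a sublinear functional that vanishes exactly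
  on \<open>S\<close>.\<close>
lemma annihilating_functional:
  fixes S :: "'v::real_normed_vector set"
  assumes S: "subspace S" "closed S" and v: "v \<notin> S"
  obtains f :: "'v \<Rightarrow>\<^sub>L real" where "\<And>x. x \<in> S \<Longrightarrow> f x = 0" "f v > 0"
proof -
  have ne: "S \<noteq> {}" and zS: "0 \<in> S" using subspace_0[OF S(1)] by auto
  have near: "\<exists>a\<in>S. dist x a < infdist x S + e" if "e > 0" for x e
    using that cInf_lessD[of "dist x ` S" "infdist x S + e"] ne by (auto simp: infdist_notempty)
  have "sublinear (\<lambda>x. infdist x S)"
    unfolding sublinear_def
  proof safe
    fix x y
    show "infdist (x + y) S \<le> infdist x S + infdist y S"
    proof (rule field_le_epsilon)
      fix e :: real assume "e > 0"
      then have e: "e / 2 > 0" by simp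
      obtain a where a: "a \<in> S" "dist x a < infdist x S + e / 2" using near[OF e] by blast
      obtain b where b: "b \<in> S" "dist y b < infdist y S + e / 2" using near[OF e] by blast
      have "infdist (x + y) S \<le> dist (x + y) (a + b)"
        by (rule infdist_le) (rule subspace_add[OF S(1) a(1) b(1)])
      also have "\<dots> \<le> dist x a + dist y b" by (rule dist_triangle_add)
      finally show "infdist (x + y) S \<le> infdist x S + infdist y S + e" using a(2) b(2) by simp
    qed
  next
    fix t :: real and x assume t: "t \<ge> 0"
    show "infdist (t *\<^sub>R x) S \<le> t * infdist x S"
    proof (cases "t = 0")
      case True
      then show ?thesis using infdist_zero[OF zS] by simp
    next
      case False
      have "infdist (t *\<^sub>R x) S / t \<le> infdist x S"
        unfolding infdist_notempty[OF ne, of x]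
      proof (rule cINF_greatest[OF ne])
        fix a assume "a \<in> S"
        then have "infdist (t *\<^sub>R x) S \<le> dist (t *\<^sub>R x) (t *\<^sub>R a)"
          by (intro infdist_le subspace_scale[OF S(1)])
        also have "\<dots> = t * dist x a"
          using t by (simp add: dist_norm flip: scaleR_diff_right)
        finally show "infdist (t *\<^sub>R x) S / t \<le> dist x a" using t False by (simp add: field_simps)
      qed
      then show ?thesis using t False by (simp add: field_simps)
    qed
  qed
  then obtain f :: "'v \<Rightarrow> real" where f: "linear f" "f \<le> (\<lambda>x. infdist x S)" "f v = infdist v S"
    by (rule hahn_banach_sublinear)
  have dist_le: "f x \<le> infdist x S" for x using le_funD[OF f(2)] .
  have le: "f x \<le> norm x" for x using dist_le[of x] infdist_le[OF zS, of x] by simp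
  have bound: "norm (f x) \<le> norm x * 1" for x
    using le[of x] le[of "- x"] linear_neg[OF f(1), of x] by (simp add: abs_le_iff)
  have bl: "bounded_linear f"
    using f(1) bound by (intro bounded_linear_intro[of f 1]) (auto simp: linear_add linear_scale)
  show ?thesis
  proof
    fix x assume "x \<in> S"
    then have "f x \<le> 0" "f (- x) \<le> 0"
      using dist_le[of x] dist_le[of "- x"] subspace_neg[OF S(1)] by auto
    then show "Blinfun f x = 0"
      using linear_neg[OF f(1), of x] by (simp add: bounded_linear_Blinfun_apply[OF bl])
  next
    show "Blinfun f v > 0"
      using f(3) v infdist_pos_not_in_closed[OF S(2) ne] by (simp add: bounded_linear_Blinfun_apply[OF bl])
  qed
qed

section \<open>Weak-star slices of dual balls\<close>

lemma near_norm_attained: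
  fixes f :: "'v::real_normed_vector \<Rightarrow>\<^sub>L 'w::real_normed_vector"
  assumes c_less: "c < norm f"
  obtains x where "norm x \<le> 1" "c < norm (f x)"
proof (rule ccontr)
  assume no_thesis: "\<not> thesis"
  note attained = that
  have le: "norm (f x) \<le> c" if x: "norm x \<le> 1" for x
  proof (rule ccontr)
    assume "\<not> norm (f x) \<le> c"
    then have "c < norm (f x)" by simp
    from attained[OF x this] no_thesis show False by contradiction
  qed
  from le[of 0] have c: "0 \<le> c" by simp
  have "norm f \<le> c"
  proof (rule norm_blinfun_bound[OF c])
    fix x show "norm (f x) \<le> c * norm x"
    proof (cases "x = 0")
      case False
      then have "norm (f x) / norm x \<le> c"
        using le[of "x /\<^sub>R norm x"] by (simp add: blinfun.scaleR_right divide_inverse mult.commute)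
      with False show ?thesis by (simp add: pos_divide_le_eq)
    qed simp
  qed
  with c_less show False by simp
qed

lemma SUP_dual_ball:
  fixes z :: "'a::real_normed_vector"
  shows "(SUP g\<in>cball 0 1. blinfun_apply g z) = norm z"
proof (rule cSup_eq_maximum)
  obtain f :: "'a \<Rightarrow>\<^sub>L real" where "norm f \<le> 1" "f z = norm z" by (rule norming_functional)
  then show "norm z \<in> (\<lambda>g. blinfun_apply g z) ` cball 0 1" by (intro image_eqI[of _ _ f]) auto
next
  fix r :: real assume "r \<in> (\<lambda>g. blinfun_apply g z) ` cball 0 1"
  then obtain g :: "'a \<Rightarrow>\<^sub>L real" where g: "norm g \<le> 1" "r = blinfun_apply g z" by auto
  have "r \<le> norm g * norm z" using norm_blinfun[of g z] g(2) by simp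
  with g(1) mult_right_mono[of "norm g" 1 "norm z"] show "r \<le> norm z" by simp
qed

lemma weakstar_slice_eq: "weakstar_slice z \<alpha> = {f \<in> cball 0 1. norm z - \<alpha> < blinfun_apply f z}"
  by (simp add: weakstar_slice_def SUP_dual_ball)

lemma openin_weak_vimage:
  fixes f :: "'z::real_normed_vector \<Rightarrow>\<^sub>L real"
  shows "open U \<Longrightarrow> openin weak_topology (blinfun_apply f -` U)"
  unfolding weak_topology_def by (rule topology_generated_by_Basis) blast

lemma topspace_weak_topology [simp]: "topspace weak_topology = UNIV"
  using openin_subset[OF openin_weak_vimage[OF open_UNIV]] by auto

lemma continuous_map_weak_topology:
  fixes F :: "'v::real_normed_vector \<Rightarrow> 'w::real_normed_vector"
  assumes F: "bounded_linear F"
  shows "continuous_map weak_topology weak_topology F"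
  unfolding weak_topology_def[where 'z = 'w]
proof (rule continuous_on_generated_topo)
  fix V assume "V \<in> {blinfun_apply f -` U |(f :: 'w \<Rightarrow>\<^sub>L real) U. open U}"
  then obtain f :: "'w \<Rightarrow>\<^sub>L real" and U where V: "V = blinfun_apply f -` U" "open U"
    by (elim CollectE exE conjE) (rule that)
  have "F -` V = blinfun_apply (f o\<^sub>L Blinfun F) -` U"
    by (rule set_eqI) (simp add: V(1) bounded_linear_Blinfun_apply[OF F])
  then show "openin weak_topology (F -` V \<inter> topspace weak_topology)"
    using openin_weak_vimage[OF V(2)] by simp
next
  have "(UNIV :: 'w set) \<in> {blinfun_apply f -` U |(f :: 'w \<Rightarrow>\<^sub>L real) U. open U}"
    by (rule CollectI, rule exI[of _ 0], rule exI[of _ UNIV]) simp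
  then show "F ` topspace weak_topology \<subseteq> \<Union> {blinfun_apply f -` U |(f :: 'w \<Rightarrow>\<^sub>L real) U. open U}"
    by blast
qed

text \<open>The local base condition without relative topologies: since slices are relatively weakly open
  in the ball, only the refinement of weak neighbourhoods by slices remains.\<close>
lemma weakstar_strongly_extreme_iff:
  fixes f :: "'v::real_normed_vector \<Rightarrow>\<^sub>L real"
  shows "weakstar_strongly_extreme f \<longleftrightarrow> norm f = 1 \<and>
     (\<forall>U. openin weak_topology U \<and> f \<in> U \<longrightarrow>
        (\<exists>z \<alpha>. \<alpha> > 0 \<and> norm z - \<alpha> < blinfun_apply f z \<and> (\<forall>g. norm g \<le> 1 \<and> norm z - \<alpha> < blinfun_apply g z \<longrightarrow> g \<in> U)))"
  (is "?L \<longleftrightarrow> norm f = 1 \<and> ?R")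
proof
  assume L: ?L
  then have f: "norm f = 1"
    and base: "local_base_at (subtopology weak_topology (cball 0 1)) f
       {weakstar_slice z \<alpha> |z \<alpha>. \<alpha> > 0 \<and> f \<in> weakstar_slice z \<alpha>}"
    by (auto simp: weakstar_strongly_extreme_def)
  have ?R
  proof (intro allI impI, elim conjE)
    fix U assume U: "openin weak_topology U" "f \<in> U"
    have "openin (subtopology weak_topology (cball 0 1)) (U \<inter> cball 0 1)"
      using U(1) by (auto simp: openin_subtopology)
    moreover have "f \<in> U \<inter> cball 0 1" using U(2) f by simp
    ultimately obtain V where
      V: "V \<in> {weakstar_slice z \<alpha> |z \<alpha>. \<alpha> > 0 \<and> f \<in> weakstar_slice z \<alpha>}" "V \<subseteq> U \<inter> cball 0 1"
      using base unfolding local_base_at_def by meson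
    then obtain z \<alpha> where "V = weakstar_slice z \<alpha>" "\<alpha> > 0" "f \<in> weakstar_slice z \<alpha>"
      by (elim CollectE exE conjE) (rule that)
    with V(2) show "\<exists>z \<alpha>. \<alpha> > 0 \<and> norm z - \<alpha> < blinfun_apply f z \<and> (\<forall>g. norm g \<le> 1 \<and> norm z - \<alpha> < blinfun_apply g z \<longrightarrow> g \<in> U)"
      by (intro exI[of _ z] exI[of _ \<alpha>]) (auto simp: weakstar_slice_eq)
  qed
  with f show "norm f = 1 \<and> ?R" ..
next
  assume R: "norm f = 1 \<and> ?R"
  have "openin (subtopology weak_topology (cball 0 1)) (weakstar_slice z \<alpha>)" for z :: 'v and \<alpha>
  proof -
    have "weakstar_slice z \<alpha> = (bidual_embed z -` {norm z - \<alpha><..}) \<inter> cball 0 1"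
      by (auto simp: weakstar_slice_eq)
    then show ?thesis
      using openin_weak_vimage[of "{norm z - \<alpha><..}" "bidual_embed z"]
      by (auto simp: openin_subtopology)
  qed
  moreover have "\<exists>V\<in>{weakstar_slice z \<alpha> |z \<alpha>. \<alpha> > 0 \<and> f \<in> weakstar_slice z \<alpha>}. V \<subseteq> U"
    if U: "openin (subtopology weak_topology (cball 0 1)) U" "f \<in> U" for U
  proof -
    obtain W where W: "openin weak_topology W" "U = W \<inter> cball 0 1"
      using U(1) by (auto simp: openin_subtopology)
    have "f \<in> W" using U(2) W(2) by simp
    with R W(1) have "\<exists>z \<alpha>. \<alpha> > 0 \<and> norm z - \<alpha> < blinfun_apply f z \<and>
        (\<forall>g. norm g \<le> 1 \<and> norm z - \<alpha> < blinfun_apply g z \<longrightarrow> g \<in> W)" by simp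
    then obtain z \<alpha> where z: "\<alpha> > 0" "norm z - \<alpha> < f z"
      "\<forall>g. norm g \<le> 1 \<and> norm z - \<alpha> < blinfun_apply g z \<longrightarrow> g \<in> W"
      by (elim exE conjE) (rule that)
    have "weakstar_slice z \<alpha> \<subseteq> U" using z(3) by (auto simp: weakstar_slice_eq W(2))
    moreover have "f \<in> weakstar_slice z \<alpha>" using z(2) R by (simp add: weakstar_slice_eq)
    ultimately show ?thesis using z(1) by blast
  qed
  ultimately show ?L
    using R by (auto simp: weakstar_strongly_extreme_def local_base_at_def)
qed

lemma weakstar_strongly_extremeE:
  fixes f :: "'v::real_normed_vector \<Rightarrow>\<^sub>L real"
  assumes "weakstar_strongly_extreme f" "openin weak_topology U" "f \<in> U"
  obtains z \<alpha> where "\<alpha> > 0" "norm z - \<alpha> < f z"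
    "\<And>g. norm g \<le> 1 \<Longrightarrow> norm z - \<alpha> < blinfun_apply g z \<Longrightarrow> g \<in> U"
proof -
  have "\<exists>z \<alpha>. \<alpha> > 0 \<and> norm z - \<alpha> < blinfun_apply f z \<and>
      (\<forall>g. norm g \<le> 1 \<and> norm z - \<alpha> < blinfun_apply g z \<longrightarrow> g \<in> U)"
    using assms unfolding weakstar_strongly_extreme_iff by simp
  then show thesis
    by (elim exE conjE) (rule that, assumption, assumption, simp)
qed

text \<open>If \<open>A\<close> is a contraction with bounded linear right inverse \<open>Q\<close>, then \<open>A\<^sup>*\<close> embeds the dual ball of
  the target into that of the source, and \<open>Q\<^sup>*\<close> is a weakly continuous left inverse of \<open>A\<^sup>*\<close>. A weak
  neighbourhood \<open>U\<close> of \<open>\<psi>\<close> is pulled back along \<open>Q\<^sup>*\<close>, a slice given by \<open>T\<close> is found there, and pulled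
  back along \<open>A\<^sup>*\<close> it becomes the slice given by \<open>A T\<close>.\<close>
lemma weakstar_strongly_extreme_factor:
  fixes z :: "'v::real_normed_vector \<Rightarrow>\<^sub>L real" and \<psi> :: "'w::real_normed_vector \<Rightarrow>\<^sub>L real"
  assumes z: "weakstar_strongly_extreme z" and \<psi>: "norm \<psi> = 1"
    and A: "bounded_linear A" "\<And>v. norm (A v) \<le> norm v" and fac: "\<And>v. z v = \<psi> (A v)"
    and Q: "bounded_linear Q" "\<And>w. A (Q w) = w"
  shows "weakstar_strongly_extreme \<psi>"
  unfolding weakstar_strongly_extreme_iff
proof (intro conjI allI impI; (elim conjE)?)
  note apply_A [simp] = bounded_linear_Blinfun_apply[OF A(1)]
  note apply_Q [simp] = bounded_linear_Blinfun_apply[OF Q(1)]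
  fix U assume U: "openin weak_topology U" "\<psi> \<in> U"
  define R where "R g = g o\<^sub>L Blinfun Q" for g :: "'v \<Rightarrow>\<^sub>L real"
  have RA: "R g = h" if "\<And>v. g v = h (A v)" for g :: "'v \<Rightarrow>\<^sub>L real" and h :: "'w \<Rightarrow>\<^sub>L real"
    by (rule blinfun_eqI) (simp add: R_def that Q(2))
  have "bounded_linear R"
    unfolding R_def by (rule bounded_bilinear.bounded_linear_left[OF bounded_bilinear_blinfun_compose])
  from openin_continuous_map_preimage[OF continuous_map_weak_topology[OF this] U(1)]
  have "openin weak_topology (R -` U)" by (simp add: vimage_def)
  moreover have "z \<in> R -` U" using U(2) RA[OF fac] by simp
  ultimately obtain T \<alpha> where T: "norm T - \<alpha> < z T"
    "\<And>g. norm g \<le> 1 \<Longrightarrow> norm T - \<alpha> < blinfun_apply g T \<Longrightarrow> g \<in> R -` U"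
    by (rule weakstar_strongly_extremeE[OF z]) blast
  \<comment> \<open>As \<open>norm (A T)\<close> may be smaller than \<open>norm T\<close>, the depth shrinks by the difference. It stays positive
    because \<open>\<psi>\<close> itself lies in the slice.\<close>
  define \<beta> where "\<beta> = \<alpha> - (norm T - norm (A T))"
  have "norm T - \<alpha> < \<psi> (A T)" using T(1) fac by simp
  moreover have "\<psi> (A T) \<le> norm (A T)" using norm_blinfun[of \<psi> "A T"] \<psi> by simp
  moreover have "g \<in> U" if g: "norm g \<le> 1" "norm (A T) - \<beta> < blinfun_apply g (A T)" for g
  proof -
    have "norm (g o\<^sub>L Blinfun A) \<le> 1"
    proof (rule norm_blinfun_bound)
      fix v
      have "norm (g (A v)) \<le> norm g * norm (A v)" by (rule norm_blinfun)
      also have "\<dots> \<le> 1 * norm v" using g(1) A(2)[of v] by (intro mult_mono) auto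
      finally show "norm ((g o\<^sub>L Blinfun A) v) \<le> 1 * norm v" by simp
    qed simp
    moreover have "norm T - \<alpha> < (g o\<^sub>L Blinfun A) T" using g(2) by (simp add: \<beta>_def)
    ultimately have "g o\<^sub>L Blinfun A \<in> R -` U" by (rule T(2))
    then show ?thesis using RA[of "g o\<^sub>L Blinfun A" g] by simp
  qed
  ultimately show "\<exists>w \<alpha>. \<alpha> > 0 \<and> norm w - \<alpha> < \<psi> w \<and> (\<forall>g. norm g \<le> 1 \<and> norm w - \<alpha> < blinfun_apply g w \<longrightarrow> g \<in> U)"
    by (intro exI[of _ "A T"] exI[of _ \<beta>]) (auto simp: \<beta>_def)
qed (rule \<psi>)

section \<open>Isometric embeddings\<close>

lemma bounded_linear_bidual_embed: "bounded_linear bidual_embed"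
proof (rule bounded_linear_intro)
  fix x y :: 'a and r :: real
  show "bidual_embed (x + y) = bidual_embed x + bidual_embed y"
    by (rule blinfun_eqI) (simp add: blinfun.bilinear_simps)
  show "bidual_embed (r *\<^sub>R x) = r *\<^sub>R bidual_embed x"
    by (rule blinfun_eqI) (simp add: blinfun.bilinear_simps)
  show "norm (bidual_embed x) \<le> norm x * 1"
  proof (rule norm_blinfun_bound)
    fix f :: "'a \<Rightarrow>\<^sub>L real"
    show "norm (bidual_embed x f) \<le> (norm x * 1) * norm f"
      using norm_blinfun[of f x] by (simp add: mult.commute)
  qed simp
qed

lemma norm_bidual_embed [simp]: "norm (bidual_embed x) = norm x"
proof (rule antisym)
  show "norm (bidual_embed x) \<le> norm x"
  proof (rule norm_blinfun_bound)
    fix f :: "'a \<Rightarrow>\<^sub>L real"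
    show "norm (bidual_embed x f) \<le> norm x * norm f"
      using norm_blinfun[of f x] by (simp add: mult.commute)
  qed simp
  obtain f :: "'a \<Rightarrow>\<^sub>L real" where f: "norm f \<le> 1" "f x = norm x" by (rule norming_functional)
  have "norm x \<le> norm (bidual_embed x) * norm f" using norm_blinfun[of "bidual_embed x" f] f(2) by simp
  also have "\<dots> \<le> norm (bidual_embed x) * 1" using f(1) by (intro mult_left_mono) auto
  finally show "norm x \<le> norm (bidual_embed x)" by simp
qed

lemma closed_range_isometry:
  fixes F :: "'v::banach \<Rightarrow> 'w::real_normed_vector"
  assumes "bounded_linear F" "\<And>x. norm x \<le> norm (F x)"
  shows "closed (range F)"
  using complete_isometric_image[of 1 UNIV F] assms
  by (auto intro!: complete_imp_closed simp: complete_UNIV)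

section \<open>The projective tensor product inside the dual of the operators\<close>

lemma proj_tensor_closed_induct:
  assumes "closed S" "\<And>v. alg_to_proj v \<in> S" shows "u \<in> S"
proof -
  have "\<exists>w\<in>S. dist w u < e" if e: "e > 0" for e
  proof -
    obtain v where "norm (u - alg_to_proj v) < e" by (rule alg_to_proj_dense[OF e])
    then show ?thesis using assms(2)[of v] by (auto simp: dist_norm norm_minus_commute)
  qed
  then show ?thesis using closed_approachable[OF assms(1)] by blast
qed

lemma alg_to_proj_sum_list:
  "alg_to_proj (\<Sum>(x, y)\<leftarrow>s. alg_tensor_elem x y) = (\<Sum>(x, y)\<leftarrow>s. proj_tensor_elem x y)"
  using alg_to_proj_scaleR[of 0]
  by (induction s) (auto simp: alg_to_proj_add proj_tensor_elem_def)

text \<open>The elementary tensors span a dense subspace.\<close>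
lemma proj_tensor_closed_subspace_induct:
  assumes "subspace S" "closed S" "\<And>x y. proj_tensor_elem x y \<in> S" shows "u \<in> S"
proof (rule proj_tensor_closed_induct[OF assms(2)])
  fix v :: "('a, 'b) alg_tensor"
  obtain s where "v = (\<Sum>(x, y)\<leftarrow>s. alg_tensor_elem x y)" by (rule alg_tensor_exhaust)
  then have v: "alg_to_proj v = (\<Sum>(x, y)\<leftarrow>s. proj_tensor_elem x y)" by (simp add: alg_to_proj_sum_list)
  show "alg_to_proj v \<in> S"
    unfolding v by (induction s) (auto intro: subspace_0 subspace_add assms)
qed

lemma proj_tensor_linear_eq:
  fixes F G :: "('a::real_normed_vector, 'b::real_normed_vector) proj_tensor \<Rightarrow> 'w::real_normed_vector"
  assumes F: "bounded_linear F" and G: "bounded_linear G"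
    and eq: "\<And>x y. F (proj_tensor_elem x y) = G (proj_tensor_elem x y)"
  shows "F u = G u"
proof -
  have "u \<in> {u. F u = G u}"
  proof (rule proj_tensor_closed_subspace_induct)
    show "subspace {u. F u = G u}"
      by (rule linear_subspace_kernel[of "\<lambda>u. F u - G u", simplified])
        (intro linear_compose_sub bounded_linear.linear assms)
    show "closed {u. F u = G u}"
      by (intro closed_Collect_eq linear_continuous_on assms)
  qed (simp add: eq)
  then show ?thesis by simp
qed

lemma norm_proj_tensor_elem_le: "norm (proj_tensor_elem x y) \<le> norm x * norm y"
  using proj_norm_le[of "[(x, y)]"] by (simp add: proj_tensor_elem_def norm_alg_to_proj)

lemma bounded_bilinear_proj_tensor_elem: "bounded_bilinear proj_tensor_elem"
proof
  fix x x' :: 'a and y y' :: 'b and r :: real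
  have "alg_tensor_elem (x + x') y = alg_tensor_elem x y + alg_tensor_elem x' y"
    "alg_tensor_elem x (y + y') = alg_tensor_elem x y + alg_tensor_elem x y'"
    "alg_tensor_elem (r *\<^sub>R x) y = r *\<^sub>R alg_tensor_elem x y"
    "alg_tensor_elem x (r *\<^sub>R y) = r *\<^sub>R alg_tensor_elem x y"
    by (auto simp: alg_tensor_elem.abs_eq plus_alg_tensor.abs_eq scaleR_alg_tensor.abs_eq
        alg_tensor.abs_eq_iff bilinear_ladd bilinear_radd bilinear_lmul bilinear_rmul)
  then show "proj_tensor_elem (x + x') y = proj_tensor_elem x y + proj_tensor_elem x' y"
    "proj_tensor_elem x (y + y') = proj_tensor_elem x y + proj_tensor_elem x y'"
    "proj_tensor_elem (r *\<^sub>R x) y = r *\<^sub>R proj_tensor_elem x y"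
    "proj_tensor_elem x (r *\<^sub>R y) = r *\<^sub>R proj_tensor_elem x y"
    by (simp_all add: proj_tensor_elem_def alg_to_proj_add alg_to_proj_scaleR)
next
  have "norm (proj_tensor_elem x y) \<le> norm x * norm y * 1" for x :: 'a and y :: 'b
    using norm_proj_tensor_elem_le[of x y] by simp
  then show "\<exists>K. \<forall>x y. norm (proj_tensor_elem (x :: 'a) (y :: 'b)) \<le> norm x * norm y * K" by blast
qed

lemma tensor_pairing_alg: "tensor_pairing T (alg_to_proj v) = alg_pairing T v"
  by transfer (simp add: limI)

lemma tensor_pairing_bound: "\<bar>tensor_pairing T u\<bar> \<le> norm T * norm u"
proof -
  have "u \<in> {u. \<bar>tensor_pairing T u\<bar> \<le> norm T * norm u}"
  proof (rule proj_tensor_closed_induct)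
    show "closed {u. \<bar>tensor_pairing T u\<bar> \<le> norm T * norm u}"
      by (intro closed_Collect_le continuous_intros linear_continuous_on bounded_linear_tensor_pairing)
  qed (use alg_pairing_bound in \<open>auto simp: tensor_pairing_alg norm_alg_to_proj\<close>)
  then show ?thesis by simp
qed

lemma bounded_bilinear_tensor_pairing: "bounded_bilinear tensor_pairing"
proof
  note lin = bounded_linear.linear[OF bounded_linear_tensor_pairing]
  fix S T :: "'a \<Rightarrow>\<^sub>L 'b \<Rightarrow>\<^sub>L real" and u v :: "('a, 'b) proj_tensor" and r :: real
  show "tensor_pairing T (u + v) = tensor_pairing T u + tensor_pairing T v"
    by (rule linear_add[OF lin])
  show "tensor_pairing T (r *\<^sub>R u) = r *\<^sub>R tensor_pairing T u"
    by (rule linear_scale[OF lin])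
  show "tensor_pairing (S + T) u = tensor_pairing S u + tensor_pairing T u"
    by (rule proj_tensor_linear_eq)
      (auto intro!: bounded_linear_tensor_pairing bounded_linear_add simp: tensor_pairing_elem blinfun.bilinear_simps)
  show "tensor_pairing (r *\<^sub>R T) u = r *\<^sub>R tensor_pairing T u"
    by (rule proj_tensor_linear_eq)
      (auto intro!: bounded_linear_tensor_pairing bounded_linear_const_mult simp: tensor_pairing_elem blinfun.bilinear_simps)
next
  have "norm (tensor_pairing T u) \<le> norm T * norm u * 1"
    for T :: "'a \<Rightarrow>\<^sub>L 'b \<Rightarrow>\<^sub>L real" and u
    using tensor_pairing_bound[of T u] by simp
  then show "\<exists>K. \<forall>(T :: 'a \<Rightarrow>\<^sub>L 'b \<Rightarrow>\<^sub>L real) u. norm (tensor_pairing T u) \<le> norm T * norm u * K" by blast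
qed

text \<open>The canonical embedding of the projective tensor product into its bidual, whose elements are
  here functionals on operators.\<close>
definition operator_dual_embed ::
    "('a::real_normed_vector, 'b::real_normed_vector) proj_tensor \<Rightarrow> ('a \<Rightarrow>\<^sub>L 'b \<Rightarrow>\<^sub>L real) \<Rightarrow>\<^sub>L real" where
  "operator_dual_embed = bounded_bilinear.prod_left tensor_pairing"

lemma operator_dual_embed_apply [simp]: "operator_dual_embed u T = tensor_pairing T u"
  by (simp add: operator_dual_embed_def bounded_bilinear.prod_left.rep_eq[OF bounded_bilinear_tensor_pairing])

lemma bounded_linear_operator_dual_embed: "bounded_linear operator_dual_embed"
  unfolding operator_dual_embed_def
  by (rule bounded_bilinear.bounded_linear_prod_left[OF bounded_bilinear_tensor_pairing])

lemma operator_dual_embed_elem: "operator_dual_embed (proj_tensor_elem x y) = tensor_functional x y"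
  by (rule blinfun_eqI) (simp add: tensor_pairing_elem)

text \<open>The operator is \<open>x \<mapsto> (y \<mapsto> f (x \<otimes> y))\<close>. It pairs with all tensors as \<open>f\<close> does because elementary
  tensors span a dense subspace.\<close>
lemma functional_eq_tensor_pairing:
  fixes f :: "('a::real_normed_vector, 'b::real_normed_vector) proj_tensor \<Rightarrow>\<^sub>L real"
  obtains T :: "'a \<Rightarrow>\<^sub>L 'b \<Rightarrow>\<^sub>L real" where "norm T \<le> norm f" "\<And>u. tensor_pairing T u = f u"
proof
  note bil = bounded_bilinear_proj_tensor_elem
  define T where "T = Blinfun (\<lambda>x::'a. f o\<^sub>L bounded_bilinear.prod_right proj_tensor_elem x)"
  have "bounded_linear (\<lambda>x::'a. f o\<^sub>L bounded_bilinear.prod_right proj_tensor_elem x)"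
    by (rule bounded_linear_compose[OF bounded_bilinear.bounded_linear_right[OF bounded_bilinear_blinfun_compose]
          bounded_bilinear.bounded_linear_prod_right[OF bil]])
  then have T: "T x y = f (proj_tensor_elem x y)" for x y
    by (simp add: T_def bounded_linear_Blinfun_apply bounded_bilinear.prod_right.rep_eq[OF bil])
  show "norm T \<le> norm f"
  proof (intro norm_blinfun_bound)
    fix x y
    have "norm (T x y) \<le> norm f * norm (proj_tensor_elem x y)" unfolding T by (rule norm_blinfun)
    also have "\<dots> \<le> norm f * (norm x * norm y)"
      by (intro mult_left_mono norm_proj_tensor_elem_le) simp
    finally show "norm (T x y) \<le> norm f * norm x * norm y" by (simp add: mult.assoc)
  qed simp_all
  show "tensor_pairing T u = f u" for u
    by (rule proj_tensor_linear_eq)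
      (auto simp: tensor_pairing_elem T intro: bounded_linear_tensor_pairing blinfun.bounded_linear_right)
qed

text \<open>A norming functional of \<open>u\<close> is the pairing with an operator of norm at most one. With
  completeness, this makes the range of the embedding closed.\<close>
lemma norm_le_operator_dual_embed: "norm u \<le> norm (operator_dual_embed u)"
proof -
  obtain f :: "('a, 'b) proj_tensor \<Rightarrow>\<^sub>L real" where f: "norm f \<le> 1" "f u = norm u"
    by (rule norming_functional)
  obtain T where T: "norm T \<le> norm f" "\<And>u. tensor_pairing T u = f u"
    by (rule functional_eq_tensor_pairing[of f]) blast
  have "norm u \<le> norm (operator_dual_embed u) * norm T"
    using norm_blinfun[of "operator_dual_embed u" T] T(2)[of u] f(2) by simp
  also have "\<dots> \<le> norm (operator_dual_embed u) * 1"
    using T(1) f(1) by (intro mult_left_mono) auto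
  finally show ?thesis by simp
qed

section \<open>Slicing a tensor by functionals\<close>

definition rank_one ::
    "('a::real_normed_vector \<Rightarrow>\<^sub>L real) \<Rightarrow> 'w::real_normed_vector \<Rightarrow> 'a \<Rightarrow>\<^sub>L 'w" where
  "rank_one f g = blinfun_scaleR_left g o\<^sub>L f"

lemma rank_one_apply [simp]: "rank_one f g x = f x *\<^sub>R g"
  by (simp add: rank_one_def)

lemma bounded_linear_rank_one_left: "bounded_linear (\<lambda>f. rank_one f g)"
  unfolding rank_one_def
  by (rule bounded_bilinear.bounded_linear_right[OF bounded_bilinear_blinfun_compose])

lemma bounded_linear_rank_one_right: "bounded_linear (rank_one f)"
  unfolding rank_one_def
  by (rule bounded_linear_compose[OF bounded_bilinear.bounded_linear_left[OF bounded_bilinear_blinfun_compose]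
        bounded_linear_blinfun_scaleR_left])

text \<open>The functional \<open>f \<mapsto> tensor_pairing (Q f) u\<close> depends continuously on \<open>u\<close>. It is an evaluation at a
  point for elementary \<open>u\<close>, hence for all \<open>u\<close>, because evaluations form a closed subspace of the
  bidual. With \<open>Q f = rank_one f g\<close> or \<open>Q g = rank_one f g\<close> the point is the slice of \<open>u\<close> by a functional
  on one side. This is what puts weak-star limits of the two factors back into the original spaces.\<close>
lemma tensor_slice_exists:
  fixes Q :: "('c::banach \<Rightarrow>\<^sub>L real) \<Rightarrow> 'a::real_normed_vector \<Rightarrow>\<^sub>L 'b::real_normed_vector \<Rightarrow>\<^sub>L real"
  assumes Q: "bounded_linear Q" and elem: "\<And>x y. \<exists>w. \<forall>f. Q f x y = f w"
  obtains w where "\<And>f. tensor_pairing (Q f) u = f w"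
proof -
  define D where "D u = operator_dual_embed u o\<^sub>L Blinfun Q" for u
  have D_apply: "D u f = tensor_pairing (Q f) u" for u f
    by (simp add: D_def bounded_linear_Blinfun_apply[OF Q])
  have D: "bounded_linear D"
    unfolding D_def
    by (rule bounded_linear_compose[OF bounded_bilinear.bounded_linear_left[OF bounded_bilinear_blinfun_compose]
          bounded_linear_operator_dual_embed])
  have "u \<in> D -` range (bidual_embed :: 'c \<Rightarrow> _)"
  proof (rule proj_tensor_closed_subspace_induct)
    show "subspace (D -` range (bidual_embed :: 'c \<Rightarrow> _))"
      by (intro linear_subspace_vimage linear_subspace_image bounded_linear.linear D
          bounded_linear_bidual_embed subspace_UNIV)
    show "closed (D -` range (bidual_embed :: 'c \<Rightarrow> _))"
      by (intro continuous_closed_vimage closed_range_isometry bounded_linear_bidual_embed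
          linear_continuous_at D) simp
    fix x y
    obtain w where w: "\<And>f. Q f x y = f w" using elem by blast
    have "D (proj_tensor_elem x y) = bidual_embed w"
      by (rule blinfun_eqI) (simp add: D_apply tensor_pairing_elem w)
    then show "proj_tensor_elem x y \<in> D -` range (bidual_embed :: 'c \<Rightarrow> _)" by simp
  qed
  then obtain w where "D u = bidual_embed w" by blast
  then have "tensor_pairing (Q f) u = f w" for f
    using D_apply[of u f] by simp
  then show ?thesis by (rule that)
qed

section \<open>Limits of elementary tensors\<close>

lemma compact_cluster_point:
  assumes "compact C" "\<forall>\<^sub>F i in F. h i \<in> C" "F \<noteq> bot"
  obtains k G where "k \<in> C" "G \<le> F" "G \<noteq> bot" "(h \<longlongrightarrow> k) G"
proof -
  have "filtermap h F \<noteq> bot" "\<forall>\<^sub>F x in filtermap h F. x \<in> C"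
    using assms(2,3) by (auto simp: filtermap_bot_iff eventually_filtermap)
  then obtain k where k: "k \<in> C" "inf (nhds k) (filtermap h F) \<noteq> bot"
    using assms(1) unfolding compact_filter by blast
  let ?G = "inf F (filtercomap h (nhds k))"
  have "?G \<noteq> bot"
  proof
    assume "?G = bot"
    then have "eventually (\<lambda>_. False) ?G" by simp
    then obtain P Q where P: "eventually P F" and Q: "eventually Q (filtercomap h (nhds k))"
      and PQ: "\<And>i. P i \<Longrightarrow> Q i \<Longrightarrow> False"
      unfolding eventually_inf by blast
    obtain R where R: "eventually R (nhds k)" "\<And>i. R (h i) \<Longrightarrow> Q i"
      using Q unfolding eventually_filtercomap by blast
    have "eventually (\<lambda>x. \<not> R x) (filtermap h F)"
      unfolding eventually_filtermap using P by eventually_elim (use PQ R(2) in blast)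
    with R(1) have "eventually (\<lambda>_. False) (inf (nhds k) (filtermap h F))"
      unfolding eventually_inf by (intro exI[of _ R] exI[of _ "\<lambda>x. \<not> R x"]) simp
    with k(2) show False by (simp add: trivial_limit_def)
  qed
  moreover have "(h \<longlongrightarrow> k) ?G"
    unfolding filterlim_iff_le_filtercomap by simp
  ultimately show ?thesis using that[OF k(1), of ?G] by simp
qed

text \<open>A pointwise limit is the only possible cluster point, and in a compact set a unique cluster
  point is a limit.\<close>
lemma tendsto_compact_pointwise:
  fixes h :: "'i \<Rightarrow> 'v::real_normed_vector \<Rightarrow>\<^sub>L 'w::real_normed_vector"
  assumes C: "compact C" "\<forall>\<^sub>F i in F. h i \<in> C" and lim: "\<And>y. ((\<lambda>i. h i y) \<longlongrightarrow> blinfun_apply l y) F"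
  shows "(h \<longlongrightarrow> l) F"
proof (rule ccontr)
  assume "\<not> (h \<longlongrightarrow> l) F"
  then obtain U where U: "open U" "l \<in> U" "\<not> (\<forall>\<^sub>F i in F. h i \<in> U)"
    unfolding tendsto_def by blast
  let ?F = "inf F (principal {i. h i \<notin> U})"
  have "?F \<noteq> bot"
    using U(3) unfolding trivial_limit_def eventually_inf_principal by simp
  moreover have "\<forall>\<^sub>F i in ?F. h i \<in> C"
    using C(2) by (rule filter_leD[OF inf_le1])
  ultimately obtain k G where G: "G \<le> ?F" "G \<noteq> bot" "(h \<longlongrightarrow> k) G"
    using compact_cluster_point[OF C(1)] by blast
  have "k = l"
  proof (rule blinfun_eqI)
    fix y
    have "((\<lambda>i. h i y) \<longlongrightarrow> k y) G" by (intro tendsto_intros G(3))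
    moreover have "((\<lambda>i. h i y) \<longlongrightarrow> l y) G"
      using lim G(1) by (meson tendsto_mono inf.boundedE)
    ultimately show "k y = l y" by (rule tendsto_unique[OF G(2)])
  qed
  with G(3) U(1,2) have "\<forall>\<^sub>F i in G. h i \<in> U" unfolding tendsto_def by blast
  moreover have "\<forall>\<^sub>F i in G. h i \<notin> U"
    by (rule filter_leD[OF G(1)]) (simp add: eventually_inf_principal)
  ultimately have "\<forall>\<^sub>F i in G. False" by eventually_elim simp
  with G(2) show False by (simp add: trivial_limit_def)
qed

text \<open>Norm convergence on one side makes a bilinear pairing insensitive to how the other, bounded,
  side varies.\<close>
lemma tendsto_pairing:
  assumes "(f \<longlongrightarrow> g) F" "\<forall>\<^sub>F i in F. norm (b i) \<le> 1"
  shows "((\<lambda>i. blinfun_apply (f i) (b i) - blinfun_apply g (b i)) \<longlongrightarrow> 0) F"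
proof (rule Lim_null_comparison)
  show "((\<lambda>i. norm (f i - g)) \<longlongrightarrow> 0) F"
    using assms(1) by (intro tendsto_norm_zero) (simp add: LIM_zero_iff)
  show "\<forall>\<^sub>F i in F. norm (f i (b i) - g (b i)) \<le> norm (f i - g)"
    using assms(2)
  proof eventually_elim
    case (elim i)
    have "norm (f i (b i) - g (b i)) \<le> norm (f i - g) * norm (b i)"
      using norm_blinfun[of "f i - g" "b i"] by (simp add: blinfun.diff_left)
    also have "\<dots> \<le> norm (f i - g) * 1" using elim by (intro mult_left_mono) auto
    finally show ?case by simp
  qed
qed

text \<open>A norming functional of \<open>x\<close> is bounded by \<open>c\<close> along \<open>a\<close>.\<close>
lemma norm_weak_limit_le:
  fixes x :: "'v::real_normed_vector"
  assumes "F \<noteq> bot" "\<forall>\<^sub>F i in F. norm (a i) \<le> c"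
    "\<And>f :: 'v \<Rightarrow>\<^sub>L real. ((\<lambda>i. f (a i)) \<longlongrightarrow> f x) F"
  shows "norm x \<le> c"
proof -
  obtain f :: "'v \<Rightarrow>\<^sub>L real" where f: "norm f \<le> 1" "f x = norm x" by (rule norming_functional)
  have "\<forall>\<^sub>F i in F. f (a i) \<le> c"
    using assms(2)
  proof eventually_elim
    case (elim i)
    have "f (a i) \<le> norm f * norm (a i)" using norm_blinfun[of f "a i"] by simp
    also have "\<dots> \<le> 1 * norm (a i)" using f(1) by (intro mult_right_mono) auto
    finally show ?case using elim by simp
  qed
  from tendsto_upperbound[OF assms(3)[of f] this assms(1)] f(2) show ?thesis by simp
qed

text \<open>Take a compact operator \<open>K\<close> that does not kill \<open>u\<close>. Along a finer filter,
  \<open>K (a i)\<close> converges in norm to some \<open>k\<close>, and then \<open>k (b i)\<close> converges to the nonzero number \<open>K(u)\<close>.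
  Dividing the limits on rank one operators by it shows that \<open>a i\<close> converges weakly to a multiple \<open>x\<close> of
  the slice of \<open>u\<close> by \<open>k\<close>. Symmetrically, a functional nonzero at \<open>x\<close> gives the weak limit \<open>y\<close> of \<open>b i\<close>.
  Compact operators turn the weak convergence of \<open>a i\<close> into norm convergence, so they take the same values
  at \<open>u\<close> and at \<open>x \<otimes> y\<close>, and they separate tensors.\<close>
lemma elementary_tensor_limit:
  fixes u :: "('a::banach, 'b::banach) proj_tensor"
  assumes sep: "compact_operators_separating TYPE('a) TYPE('b)" and u: "u \<noteq> 0" and F: "F \<noteq> bot"
    and a: "\<forall>\<^sub>F i in F. norm (a i) \<le> 1" and b: "\<forall>\<^sub>F i in F. norm (b i) \<le> 1"
    and lim: "\<And>T. ((\<lambda>i. blinfun_apply (blinfun_apply T (a i)) (b i)) \<longlongrightarrow> tensor_pairing T u) F"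
  obtains x y where "norm x \<le> 1" "norm y \<le> 1" "u = proj_tensor_elem x y"
proof -
  obtain K :: "'a \<Rightarrow>\<^sub>L 'b \<Rightarrow>\<^sub>L real" where K: "compact_operator K" "tensor_pairing K u \<noteq> 0"
    using sep u unfolding compact_operators_separating_def by blast
  have inC: "\<forall>\<^sub>F i in F. T (a i) \<in> closure (blinfun_apply T ` cball 0 1)"
    for T :: "'a \<Rightarrow>\<^sub>L 'b \<Rightarrow>\<^sub>L real"
    using a by eventually_elim (auto intro!: subsetD[OF closure_subset])
  obtain k G where G: "G \<le> F" "G \<noteq> bot" and k: "((\<lambda>i. K (a i)) \<longlongrightarrow> k) G"
    using compact_cluster_point[OF _ inC[of K] F] K(1) unfolding compact_operator_def by blast
  have aG: "\<forall>\<^sub>F i in G. norm (a i) \<le> 1" and bG: "\<forall>\<^sub>F i in G. norm (b i) \<le> 1"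
    using a b G(1) by (auto intro: filter_leD)
  have limG: "((\<lambda>i. T (a i) (b i)) \<longlongrightarrow> tensor_pairing T u) G" for T :: "'a \<Rightarrow>\<^sub>L 'b \<Rightarrow>\<^sub>L real"
    by (rule tendsto_mono[OF G(1) lim])
  define c where "c = tensor_pairing K u"
  have kb: "((\<lambda>i. k (b i)) \<longlongrightarrow> c) G"
    using tendsto_diff[OF limG[of K] tendsto_pairing[OF k bG]] by (simp add: c_def)
  obtain x0 where x0: "\<And>f. tensor_pairing (rank_one f k) u = blinfun_apply f x0"
  proof (rule tensor_slice_exists[OF bounded_linear_rank_one_left])
    fix x :: 'a and y :: 'b
    show "\<exists>w. \<forall>f. rank_one f k x y = blinfun_apply f w"
      by (rule exI[of _ "k y *\<^sub>R x"]) (simp add: blinfun.bilinear_simps)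
  qed blast
  \<comment> \<open>\<open>f x0\<close> is the limit of \<open>f (a i) * k (b i)\<close>, and \<open>k (b i)\<close> tends to \<open>c\<close>.\<close>
  define x where "x = x0 /\<^sub>R c"
  have ax: "((\<lambda>i. f (a i)) \<longlongrightarrow> f x) G" for f :: "'a \<Rightarrow>\<^sub>L real"
  proof -
    have "((\<lambda>i. f (a i) * k (b i)) \<longlongrightarrow> f x0) G"
      using limG[of "rank_one f k"] x0[of f] by (simp add: blinfun.bilinear_simps)
    from tendsto_divide[OF this kb] have "((\<lambda>i. f (a i) * k (b i) / k (b i)) \<longlongrightarrow> f x) G"
      using K(2) by (simp add: c_def x_def blinfun.bilinear_simps divide_inverse mult.commute)
    moreover have "\<forall>\<^sub>F i in G. k (b i) \<noteq> 0"
      using tendsto_imp_eventually_ne[OF kb] K(2) by (simp add: c_def)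
    then have "\<forall>\<^sub>F i in G. f (a i) * k (b i) / k (b i) = f (a i)" by eventually_elim simp
    ultimately show ?thesis by (rule Lim_transform_eventually)
  qed
  have Tax: "((\<lambda>i. T (a i) y) \<longlongrightarrow> T x y) G" for T :: "'a \<Rightarrow>\<^sub>L 'b \<Rightarrow>\<^sub>L real" and y
    using ax[of "bidual_embed y o\<^sub>L T"] by simp
  have "k = K x"
    by (rule blinfun_eqI, rule tendsto_unique[OF G(2) _ Tax]) (intro tendsto_intros k)
  moreover have "k \<noteq> 0"
  proof
    assume "k = 0"
    with kb have "c = 0" using G(2) by (simp add: tendsto_const_iff)
    with K(2) show False by (simp add: c_def)
  qed
  ultimately have "\<not> (\<forall>y. K x y = 0)"
    using blinfun_eqI[of "K x" 0] by auto
  then obtain y1 where y1: "K x y1 \<noteq> 0" by blast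
  \<comment> \<open>As \<open>k = K x\<close> is nonzero, evaluating \<open>K\<close> at \<open>y1\<close> gives a functional that does not vanish at \<open>x\<close>.\<close>
  define f0 where "f0 = bidual_embed y1 o\<^sub>L K"
  have f0: "f0 x \<noteq> 0" using y1 by (simp add: f0_def)
  obtain y0 where y0: "\<And>g. tensor_pairing (rank_one f0 g) u = blinfun_apply g y0"
  proof (rule tensor_slice_exists[OF bounded_linear_rank_one_right])
    fix x :: 'a and y :: 'b
    show "\<exists>w. \<forall>g. blinfun_apply (blinfun_apply (rank_one f0 g) x) y = blinfun_apply g w"
      by (rule exI[of _ "f0 x *\<^sub>R y"]) (simp add: blinfun.bilinear_simps)
  qed blast
  define y where "y = y0 /\<^sub>R f0 x"
  have b_lim: "((\<lambda>i. g (b i)) \<longlongrightarrow> g y) G" for g :: "'b \<Rightarrow>\<^sub>L real"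
  proof -
    have "((\<lambda>i. f0 (a i) * g (b i)) \<longlongrightarrow> g y0) G"
      using limG[of "rank_one f0 g"] y0[of g] by (simp add: blinfun.bilinear_simps)
    from tendsto_divide[OF this ax[of f0] f0]
    have "((\<lambda>i. f0 (a i) * g (b i) / f0 (a i)) \<longlongrightarrow> g y) G"
      by (simp add: y_def blinfun.bilinear_simps divide_inverse mult.commute)
    moreover have "\<forall>\<^sub>F i in G. f0 (a i) \<noteq> 0"
      by (rule tendsto_imp_eventually_ne[OF ax f0])
    then have "\<forall>\<^sub>F i in G. f0 (a i) * g (b i) / f0 (a i) = g (b i)" by eventually_elim simp
    ultimately show ?thesis by (rule Lim_transform_eventually)
  qed
  have pair: "tensor_pairing T u = T x y" if T: "compact_operator T" for T :: "'a \<Rightarrow>\<^sub>L 'b \<Rightarrow>\<^sub>L real"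
  proof -
    have "((\<lambda>i. T (a i)) \<longlongrightarrow> T x) G"
      by (rule tendsto_compact_pointwise[OF _ filter_leD[OF G(1) inC] Tax])
        (use T in \<open>simp add: compact_operator_def\<close>)
    from tendsto_add[OF tendsto_pairing[OF this bG] b_lim[of "T x"]]
    have "((\<lambda>i. T (a i) (b i)) \<longlongrightarrow> T x y) G" by simp
    from tendsto_unique[OF G(2) limG this] show ?thesis .
  qed
  have "u - proj_tensor_elem x y = 0"
  proof (rule ccontr)
    assume "u - proj_tensor_elem x y \<noteq> 0"
    then obtain T :: "'a \<Rightarrow>\<^sub>L 'b \<Rightarrow>\<^sub>L real" where
      T: "compact_operator T" "tensor_pairing T (u - proj_tensor_elem x y) \<noteq> 0"
      using sep unfolding compact_operators_separating_def by blast
    have "tensor_pairing T (u - proj_tensor_elem x y) = 0"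
      using pair[OF T(1)]
      by (simp add: bounded_bilinear.diff_right[OF bounded_bilinear_tensor_pairing] tensor_pairing_elem)
    with T(2) show False ..
  qed
  moreover have "norm x \<le> 1" by (rule norm_weak_limit_le[OF G(2) aG ax])
  moreover have "norm y \<le> 1" by (rule norm_weak_limit_le[OF G(2) bG b_lim])
  ultimately show ?thesis using that[of x y] by simp
qed

section \<open>Strongly extreme points are elementary tensors\<close>

lemma near_norm_attained_at_elementary_tensor:
  fixes T :: "'a::real_normed_vector \<Rightarrow>\<^sub>L 'b::real_normed_vector \<Rightarrow>\<^sub>L real"
  assumes "c < norm T"
  obtains x y where "norm x \<le> 1" "norm y \<le> 1" "c < T x y"
proof -
  obtain x where x: "norm x \<le> 1" "c < norm (T x)" by (rule near_norm_attained[OF assms])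
  obtain y where y: "norm y \<le> 1" "c < norm (T x y)" by (rule near_norm_attained[OF x(2)])
  show ?thesis
  proof (cases "T x y \<ge> 0")
    case True
    with x y show ?thesis by (intro that[of x y]) auto
  next
    case False
    with x y show ?thesis by (intro that[of x "- y"]) (auto simp: blinfun.minus_right)
  qed
qed

lemma norm_tensor_functional_le: "norm (tensor_functional x y) \<le> norm x * norm y"
proof (rule norm_blinfun_bound)
  fix T :: "'a \<Rightarrow>\<^sub>L 'b \<Rightarrow>\<^sub>L real"
  have "norm (T x y) \<le> norm (T x) * norm y" by (rule norm_blinfun)
  also have "\<dots> \<le> norm T * norm x * norm y" by (intro mult_right_mono norm_blinfun) auto
  finally show "norm (tensor_functional x y T) \<le> norm x * norm y * norm T" by (simp add: mult_ac)
qed simp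

text \<open>The neighbourhood contains a slice around \<open>z\<close>, and every slice of the ball contains an
  elementary tensor because the norm of an operator is a supremum over pairs from the unit balls.\<close>
lemma weak_neighbourhood_contains_elementary_tensor:
  fixes z :: "('a::real_normed_vector \<Rightarrow>\<^sub>L 'b::real_normed_vector \<Rightarrow>\<^sub>L real) \<Rightarrow>\<^sub>L real"
  assumes z: "weakstar_strongly_extreme z" and U: "openin weak_topology U" "z \<in> U"
  obtains x y where "norm x \<le> 1" "norm y \<le> 1" "tensor_functional x y \<in> U"
proof -
  obtain T \<alpha> where T: "\<alpha> > 0"
    "\<And>g. norm g \<le> 1 \<Longrightarrow> norm T - \<alpha> < blinfun_apply g T \<Longrightarrow> g \<in> U"
    by (rule weakstar_strongly_extremeE[OF z U]) blast
  have "norm T - \<alpha> < norm T" using T(1) by simp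
  then obtain x y where xy: "norm x \<le> 1" "norm y \<le> 1" "norm T - \<alpha> < T x y"
    by (rule near_norm_attained_at_elementary_tensor)
  have "norm (tensor_functional x y) \<le> 1"
    using norm_tensor_functional_le[of x y] mult_mono[OF xy(1,2)] by simp
  then have "tensor_functional x y \<in> U" using xy(3) by (intro T(2)) auto
  with xy(1,2) show ?thesis by (rule that)
qed

text \<open>Being a weak limit of elementary tensors, \<open>z\<close> cannot be separated by a functional from the
  projective tensor product, which is norm closed.\<close>
lemma weakstar_strongly_extreme_in_proj_tensor:
  fixes z :: "('a::real_normed_vector \<Rightarrow>\<^sub>L 'b::real_normed_vector \<Rightarrow>\<^sub>L real) \<Rightarrow>\<^sub>L real"
  assumes z: "weakstar_strongly_extreme z"
  obtains u where "z = operator_dual_embed u"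
proof -
  let ?J = "operator_dual_embed :: ('a, 'b) proj_tensor \<Rightarrow> _"
  have "z \<in> range ?J"
  proof (rule ccontr)
    assume z_out: "z \<notin> range ?J"
    have "subspace (range ?J)"
      by (intro linear_subspace_image bounded_linear.linear bounded_linear_operator_dual_embed subspace_UNIV)
    moreover have "closed (range ?J)"
      by (rule closed_range_isometry[OF bounded_linear_operator_dual_embed norm_le_operator_dual_embed])
    ultimately obtain \<Phi> :: "_ \<Rightarrow>\<^sub>L real" where
      \<Phi>: "\<And>w. w \<in> range ?J \<Longrightarrow> blinfun_apply \<Phi> w = 0" "blinfun_apply \<Phi> z > 0"
      using annihilating_functional[OF _ _ z_out] by blast
    have "openin weak_topology (blinfun_apply \<Phi> -` {0<..})" by (rule openin_weak_vimage) simp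
    moreover have "z \<in> blinfun_apply \<Phi> -` {0<..}" using \<Phi>(2) by simp
    ultimately obtain x :: 'a and y :: 'b where "tensor_functional x y \<in> blinfun_apply \<Phi> -` {0<..}"
      by (rule weak_neighbourhood_contains_elementary_tensor[OF z])
    moreover have "\<Phi> (tensor_functional x y) = 0"
      by (rule \<Phi>(1)) (metis operator_dual_embed_elem rangeI)
    ultimately show False by simp
  qed
  then show ?thesis using that by blast
qed

text \<open>The pairs in the unit balls, filtered by the weak neighbourhoods of \<open>z\<close> that contain their
  tensors, form a proper filter along which the elementary tensors converge to \<open>z\<close>.\<close>
lemma weakstar_strongly_extreme_eq_elementary_tensor:
  fixes z :: "('a::banach \<Rightarrow>\<^sub>L 'b::banach \<Rightarrow>\<^sub>L real) \<Rightarrow>\<^sub>L real"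
  assumes sep: "compact_operators_separating TYPE('a) TYPE('b)" and z: "weakstar_strongly_extreme z"
  obtains x y where "norm x = 1" "norm y = 1" "z = tensor_functional x y"
proof -
  obtain u where u: "z = operator_dual_embed u" by (rule weakstar_strongly_extreme_in_proj_tensor[OF z])
  have nz: "norm z = 1" using z by (simp add: weakstar_strongly_extreme_iff)
  have "u \<noteq> 0"
  proof
    assume "u = 0"
    then have "z = 0"
      using u bounded_linear.linear[OF bounded_linear_operator_dual_embed, THEN linear_0] by simp
    with nz show False by simp
  qed
  let ?t = "\<lambda>(x, y). tensor_functional x y"
  define F where "F = inf (filtercomap ?t (nhdsin weak_topology z))
    (principal {(x :: 'a, y :: 'b). norm x \<le> 1 \<and> norm y \<le> 1})"
  have ev: "eventually P F \<longleftrightarrow> (\<exists>U. openin weak_topology U \<and> z \<in> U \<and>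
      (\<forall>x y. norm x \<le> 1 \<and> norm y \<le> 1 \<and> tensor_functional x y \<in> U \<longrightarrow> P (x, y)))" for P
    unfolding F_def eventually_inf_principal eventually_filtercomap eventually_nhdsin by auto
  have "F \<noteq> bot"
  proof
    assume "F = bot"
    then have "eventually (\<lambda>_. False) F" by simp
    then obtain U where U: "openin weak_topology U" "z \<in> U"
      "\<And>(x :: 'a) (y :: 'b). norm x \<le> 1 \<Longrightarrow> norm y \<le> 1 \<Longrightarrow> tensor_functional x y \<notin> U"
      unfolding ev by auto
    obtain x :: 'a and y :: 'b where "norm x \<le> 1" "norm y \<le> 1" "tensor_functional x y \<in> U"
      by (rule weak_neighbourhood_contains_elementary_tensor[OF z U(1,2)])
    with U(3) show False by simp
  qed
  moreover have "\<forall>\<^sub>F p in F. norm (fst p) \<le> 1" "\<forall>\<^sub>F p in F. norm (snd p) \<le> 1"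
    unfolding ev by (auto intro!: exI[of _ UNIV] simp: openin_topspace[of weak_topology, simplified])
  moreover have "((\<lambda>p. T (fst p) (snd p)) \<longlongrightarrow> tensor_pairing T u) F" for T :: "'a \<Rightarrow>\<^sub>L 'b \<Rightarrow>\<^sub>L real"
  proof (rule topological_tendstoI)
    fix V :: "real set" assume V: "open V" "tensor_pairing T u \<in> V"
    show "\<forall>\<^sub>F p in F. T (fst p) (snd p) \<in> V"
      unfolding ev
      by (rule exI[of _ "blinfun_apply (bidual_embed T) -` V"])
        (use V u openin_weak_vimage[of V "bidual_embed T"] in auto)
  qed
  ultimately obtain x y where xy: "norm x \<le> 1" "norm y \<le> 1" "u = proj_tensor_elem x y"
    using elementary_tensor_limit[OF sep \<open>u \<noteq> 0\<close>] by blast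
  have zxy: "z = tensor_functional x y" using u xy(3) operator_dual_embed_elem by metis
  then have "1 \<le> norm x * norm y" using norm_tensor_functional_le[of x y] nz by simp
  moreover have "norm x * norm y \<le> norm x" "norm x * norm y \<le> norm y"
    using xy(1,2) by (simp_all add: mult_left_le mult_left_le_one_le)
  ultimately have "norm x = 1" "norm y = 1" using xy(1,2) by auto
  with zxy show ?thesis using that by blast
qed

section \<open>The factors inherit strong extremality\<close>

lemma unit_vector_functional:
  fixes x :: "'v::real_normed_vector"
  assumes "norm x = 1"
  obtains f :: "'v \<Rightarrow>\<^sub>L real" where "f x = 1"
  using assms norming_functional[of x] by metis

text \<open>Fixing \<open>y\<close> sends an operator \<open>T\<close> to the functional \<open>x \<mapsto> T x y\<close>. This is a contraction, with right
  inverse \<open>f \<mapsto> rank_one f g\<close> as soon as \<open>g y = 1\<close>, and \<open>x \<otimes> y\<close> is evaluation at \<open>x\<close> after it.\<close>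
lemma weakstar_strongly_extreme_left_factor:
  fixes x :: "'a::real_normed_vector" and y :: "'b::real_normed_vector"
  assumes z: "weakstar_strongly_extreme (tensor_functional x y)" and xy: "norm x = 1" "norm y = 1"
  shows "weakstar_strongly_extreme (bidual_embed x)"
proof -
  obtain g :: "'b \<Rightarrow>\<^sub>L real" where g: "g y = 1" by (rule unit_vector_functional[OF xy(2)])
  show ?thesis
  proof (rule weakstar_strongly_extreme_factor[OF z])
    show "bounded_linear (\<lambda>T. bidual_embed y o\<^sub>L T)"
      by (rule bounded_bilinear.bounded_linear_right[OF bounded_bilinear_blinfun_compose])
    show "norm (bidual_embed y o\<^sub>L T) \<le> norm T" for T :: "'a \<Rightarrow>\<^sub>L 'b \<Rightarrow>\<^sub>L real"
      using norm_blinfun_compose[of "bidual_embed y" T] xy(2) by simp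
    show "bounded_linear (\<lambda>f. rank_one f g)" by (rule bounded_linear_rank_one_left)
    show "bidual_embed y o\<^sub>L rank_one f g = f" for f :: "'a \<Rightarrow>\<^sub>L real"
      by (rule blinfun_eqI) (simp add: blinfun.bilinear_simps g)
  qed (simp_all add: xy)
qed

text \<open>The same argument with the contraction \<open>T \<mapsto> T x\<close> and its right inverse \<open>rank_one f\<close> for \<open>f x = 1\<close>.\<close>
lemma weakstar_strongly_extreme_right_factor:
  fixes x :: "'a::real_normed_vector" and y :: "'b::real_normed_vector"
  assumes z: "weakstar_strongly_extreme (tensor_functional x y)" and xy: "norm x = 1" "norm y = 1"
  shows "weakstar_strongly_extreme (bidual_embed y)"
proof -
  obtain f :: "'a \<Rightarrow>\<^sub>L real" where f: "f x = 1" by (rule unit_vector_functional[OF xy(1)])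
  show ?thesis
  proof (rule weakstar_strongly_extreme_factor[OF z])
    show "bounded_linear (\<lambda>T. blinfun_apply T x)" by (rule blinfun.bounded_linear_left)
    show "norm (T x) \<le> norm T" for T :: "'a \<Rightarrow>\<^sub>L 'b \<Rightarrow>\<^sub>L real"
      using norm_blinfun[of T x] xy(1) by simp
    show "bounded_linear (rank_one f)" by (rule bounded_linear_rank_one_right)
    show "rank_one f g x = g" for g :: "'b \<Rightarrow>\<^sub>L real" by (simp add: f)
  qed (simp_all add: xy)
qed

theorem corollary3p5:
  fixes z :: "('a::banach \<Rightarrow>\<^sub>L 'b::banach \<Rightarrow>\<^sub>L real) \<Rightarrow>\<^sub>L real"
  assumes "compact_operators_separating TYPE('a) TYPE('b)"
    and "z \<in> sphere 0 1"
    and "weakstar_strongly_extreme z"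
  shows "\<exists>(x :: 'a) (y :: 'b). x \<in> sphere 0 1 \<and> y \<in> sphere 0 1 \<and> z = tensor_functional x y \<and>
           weakstar_strongly_extreme (bidual_embed x) \<and> weakstar_strongly_extreme (bidual_embed y)"
proof -
  obtain x y where xy: "norm x = 1" "norm y = 1" "z = tensor_functional x y"
    by (rule weakstar_strongly_extreme_eq_elementary_tensor[OF assms(1,3)])
  then have "weakstar_strongly_extreme (bidual_embed x)" "weakstar_strongly_extreme (bidual_embed y)"
    using assms(3) weakstar_strongly_extreme_left_factor weakstar_strongly_extreme_right_factor by auto
  with xy show ?thesis by (intro exI[of _ x] exI[of _ y]) simp
qed

end
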